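(* For integers $n\ge 1$ and $k\ge 1$ let $p_0(n,k)$ denote the number of partitions of $\{1,\dots,n\}$ of genus one having $k$ parts. Then, as formal power series, $$P_0(x,y)=\sum_{n\geq 4}\sum_{k\geq 2} p_0(n,k)\,x^n y^k=\frac{x^4y^2}{\bigl(1-2(1+y)x+x^2(1-y)^2\bigr)^{5/2}}.$$
   Context: For $n\ge 1$ let $\zeta_n\in S_n$ be the cyclic permutation $\zeta_n(i)=i+1$ for $i<n$, $\zeta_n(n)=1$. Permutations are composed right to left ($\alpha\beta(i)=\alpha(\beta(i))$), and $z(\pi)$ denotes the number of cycles of $\pi$ (fixed points included). The genus $g(\alpha)$ of $\alpha\in S_n$ is the non-negative integer defined by $n+1-2g(\alpha)=z(\alpha)+z(\alpha^{-1}\zeta_n)$. A partition $P$ of $\{1,\dots,n\}$ is identified with the permutation $\alpha_P$ whose cycles are the blocks of $P$, each block written with its elements in increasing order; the genus of $P$ is the genus of $\alpha_P$, and the parts of $P$ are the cycles of $\alpha_P$. *)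

theory Defs
  imports
    "HOL-Combinatorics.Combinatorics"
    "HOL-Library.Disjoint_Sets"
    "HOL-Computational_Algebra.Formal_Power_Series"
begin

definition zeta :: "nat \<Rightarrow> nat \<Rightarrow> nat" where
  "zeta n i = (if 1 \<le> i \<and> i < n then i + 1 else if i = n then 1 else i)"

(* The orbit of i under a permutation of a finite set contains i, so fixed points
   count as one-element cycles. *)
definition num_cycles :: "nat \<Rightarrow> (nat \<Rightarrow> nat) \<Rightarrow> nat" where
  "num_cycles n \<pi> = card (orbit \<pi> ` {1..n})"

(* "The genus of \<alpha> is g", as a relation: the equation determines g, and stating it
   this way avoids a default value in case no natural number solved it.
   It is stated over int because of the subtraction. *)
definition has_genus :: "nat \<Rightarrow> (nat \<Rightarrow> nat) \<Rightarrow> nat \<Rightarrow> bool" where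
  "has_genus n \<alpha> g \<longleftrightarrow>
     int n + 1 - 2 * int g = int (num_cycles n \<alpha>) + int (num_cycles n (inv \<alpha> \<circ> zeta n))"

(* cycle_of_list [a, b, ..., c] is the cycle a -> b -> ... -> c -> a. *)
definition perm_of_partition :: "nat set set \<Rightarrow> nat \<Rightarrow> nat" where
  "perm_of_partition P i =
     (if i \<in> \<Union>P
      then cycle_of_list (sorted_list_of_set (THE B. B \<in> P \<and> i \<in> B)) i
      else i)"

definition p0 :: "nat \<Rightarrow> nat \<Rightarrow> nat" where
  "p0 n k = card {P. partition_on {1..n} P \<and> card P = k \<and> has_genus n (perm_of_partition P) 1}"

(* Power series in x and y are series in x (outer) whose coefficients are series in y (inner). *)
abbreviation x_var :: "rat fps fps" where
  "x_var \<equiv> fps_X"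

abbreviation y_var :: "rat fps fps" where
  "y_var \<equiv> fps_const fps_X"

definition P0 :: "rat fps fps" where
  "P0 = Abs_fps (\<lambda>n. Abs_fps (\<lambda>k. if 4 \<le> n \<and> 2 \<le> k then of_nat (p0 n k) else 0))"

(* F^a = (1 + u)^a = \<Sum>m. (a gchoose m) u^m with u = F - 1; meaningful for fps_nth F 0 = 1,
   which makes the sum a formal composition. *)
definition fps_qpow :: "rat fps fps \<Rightarrow> rat \<Rightarrow> rat fps fps" where
  "fps_qpow F a = Abs_fps (\<lambda>m. fps_const (a gchoose m)) oo (F - 1)"

lemma fps_qpow_add:
  assumes "fps_nth F 0 = 1"
  shows "fps_qpow F (a + b) = fps_qpow F a * fps_qpow F b"
proof -
  let ?B = "\<lambda>c::rat. Abs_fps (\<lambda>m. fps_const (c gchoose m)) :: rat fps fps"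
  have "?B (a + b) = ?B a * ?B b"
  proof (rule fps_ext)
    fix n
    have "fps_const ((a + b) gchoose n)
        = fps_const (\<Sum>k=0..n. (a gchoose k) * (b gchoose (n - k)))"
      by (simp add: gbinomial_Vandermonde)
    also have "\<dots> = (\<Sum>k=0..n. fps_const ((a gchoose k) * (b gchoose (n - k))))"
      by (rule fps_ext) (simp add: fps_sum_nth)
    finally show "fps_nth (?B (a + b)) n = fps_nth (?B a * ?B b) n"
      by (simp add: fps_mult_nth)
  qed
  then show ?thesis
    using fps_compose_mult_distrib[of "F - 1" "?B a" "?B b"] assms
    by (simp add: fps_qpow_def)
qed

lemma fps_qpow_1:
  assumes "fps_nth F 0 = 1"
  shows "fps_qpow F 1 = F"
proof -
  have "(Abs_fps (\<lambda>m. fps_const ((1::rat) gchoose m)) :: rat fps fps) = 1 + fps_X"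
  proof (rule fps_ext)
    fix n
    have "(1::rat) gchoose n = of_nat (1 choose n)"
      using binomial_gbinomial[of 1 n, where ?'a = rat] by simp
    then show "fps_nth (Abs_fps (\<lambda>m. fps_const ((1::rat) gchoose m))) n = fps_nth (1 + fps_X :: rat fps fps) n"
      by (cases n; cases "n - 1") (auto simp: binomial_eq_0)
  qed
  then show ?thesis
    using assms by (simp add: fps_qpow_def fps_compose_add_distrib)
qed

(* The coefficients rat fps only form a ring; division by a series with constant term 1
   is nevertheless the true quotient. *)
lemma fps_divide_const_term_1:
  fixes F G :: "rat fps fps"
  assumes "fps_nth G 0 = 1"
  shows "F / G * G = F"
proof -
  have sub: "subdegree G = 0"
    using assms by (simp add: subdegree_eq_0_iff)
  have "G * inverse G = 1"
  proof -
    have "inverse (fps_nth G 0) = 1"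
      using assms by (metis fps_inverse_one)
    then show ?thesis
      using fps_right_inverse[of G "inverse (fps_nth G 0)"] assms
      by (metis fps_inverse_def mult_1)
  qed
  moreover have "F / G = F * inverse G"
    unfolding fps_divide_def using sub by simp
  ultimately show ?thesis
    by (simp add: mult.assoc mult.commute[of "inverse G"])
qed

end

(* Let alpha be the permutation of a genus one partition and beta = alpha^-1 zeta. Deleting a point
   fixed by alpha or by beta preserves the genus. By inclusion-exclusion over sets S and T of such
   points, where a point of T is never followed cyclically by one of S, the series P of all genus
   one partitions is related to the series R of those for which alpha and beta have no fixed point:
     (1+x)(1+xy) R(x) = (1 - x^2 y) P(w),   w = x / ((1+x)(1+xy)).
   For the latter partitions n = z(alpha) + z(beta) + 1 bounds the cycle lengths: alpha is a
   fixed point free involution, and all cycles of beta have length two except one of length four or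
   two of length three. The 4 or 6 points on the exceptional cycles cut the circle into runs, each
   of which alpha reverses onto the opposite run. So n = 2c, the set of these points is invariant
   under rotation by c, and it is an arbitrary union of 2 or 3 antipodal pairs. Hence R is the sum
   of (binom(c,2) + binom(c,3)) x^(2c) y^c, that is x^4 y^2 / (1 - x^2 y)^4. The substitution w
   turns 1 - 2(1+y)x + x^2(1-y)^2 into ((1 - x^2 y) / ((1+x)(1+xy)))^2, which gives P. *)
theory Submission
  imports Defs
begin

section \<open>Counting cycles of permutations\<close>

text \<open>A point i of T has alpha(i) = zeta(i); were zeta(i) in S, alpha would send both i and
  zeta(i) to zeta(i). So only admissible pairs contribute, and the gap between unmarked points is a
  run of S followed by a run of T. The signed sum over such gaps is 1 / ((1+xy)(1+x)), which is the
  origin of w.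

  The excesses n - 2 z(alpha) and n - 2 z(beta) of the cycle lengths over two add up to 2. The
  obstacle is to show that all of it falls on beta. Under the arc of any chord lie two points on
  cycles of beta of length at least three; a block of alpha with three points has two disjoint such
  arcs, hence four such points, where beta could have at most three.

  For the shape of the remaining diagrams the circle is unrolled to the integers: arcs become
  intervals and the antipodal map a translation. The substitution by w is never inverted: the
  claimed series is composed with w as well, and composition with a nonzero w is injective.\<close>

definition cycle_count :: "'a set \<Rightarrow> ('a \<Rightarrow> 'a) \<Rightarrow> nat" where
  "cycle_count A f = card (orbit f ` A)"

lemma self_in_orbit:
  assumes "f permutes A" "finite A"
  shows "x \<in> orbit f x"
  using assms by (intro permutation_self_in_orbit) (auto simp: permutation_permutes)

lemma orbit_eq_of_mem:
  assumes "f permutes A" "finite A" "y \<in> orbit f x"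
  shows "orbit f y = orbit f x"
  using assms by (intro orbit_cyclic_eq3 cyclic_on_orbit)

text \<open>The permutation \<open>transpose j (f j) \<circ> f\<close> is \<open>f\<close> with \<open>j\<close> removed from its cycle.\<close>

lemma orbit_remove:
  assumes f: "f permutes A" and i: "i \<in> A" "i \<noteq> j" and j: "f j \<noteq> j"
  shows "orbit (transpose j (f j) \<circ> f) i = orbit f i - {j}"
proof -
  define g where "g = transpose j (f j) \<circ> f"
  have inj: "f x = f y \<longleftrightarrow> x = y" for x y
    using permutes_inj[OF f] by (auto dest: injD)
  have g: "g x = (if x = j then j else if f x = j then f j else f x)" for x
    by (auto simp: g_def transpose_def inj)
  have **: "x \<in> orbit f i \<and> x \<noteq> j" if "x \<in> orbit g i" for x
    using that
  proof induction
    case base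
    show ?case using i j orbit.base[of f i] orbit.step[of "f i" f i] by (auto simp: g)
  next
    case (step x)
    then show ?case using i j orbit.step[of x f i] orbit.step[of "f x" f i] by (auto simp: g)
  qed
  have *: "if x = j then f j \<in> orbit g i else x \<in> orbit g i" if "x \<in> orbit f i" for x
    using that
  proof induction
    case base
    show ?case using i j orbit.base[of g i] unfolding g[of i] by (cases "f i = j") simp_all
  next
    case (step x)
    then show ?case
      using j orbit.step[of x g i] unfolding g by (cases "x = j"; cases "f x = j") simp_all
  qed
  have "x \<in> orbit g i" if "x \<in> orbit f i" "x \<noteq> j" for x
    using *[OF that(1)] that(2) by simp
  with ** show ?thesis unfolding g_def[symmetric] by blast
qed

text \<open>Deleting \<open>j\<close> leaves its cycle nonempty, because \<open>f j\<close> stays,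
  and \<open>C - {j}\<close> still determines the cycle C, because two cycles with a common point
  agree.\<close>

lemma cycle_count_remove:
  assumes f: "f permutes A" "finite A" and j: "j \<in> A" "f j \<noteq> j"
  shows "cycle_count (A - {j}) (transpose j (f j) \<circ> f) = cycle_count A f"
proof -
  have fj: "f j \<in> A - {j}" using f j by (auto simp: permutes_in_image)
  have A: "orbit f ` A = orbit f ` (A - {j})"
  proof -
    have "orbit f j = orbit f (f j)"
      by (rule orbit_eq_of_mem[OF f, symmetric]) (rule orbit.base)
    then have "orbit f j \<in> orbit f ` (A - {j})" using fj by auto
    then show ?thesis by auto
  qed
  have "orbit (transpose j (f j) \<circ> f) ` (A - {j}) = (\<lambda>C. C - {j}) ` orbit f ` (A - {j})"
    unfolding image_image using orbit_remove[OF f(1) _ _ j(2)] by (intro image_cong) auto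
  also have "card \<dots> = card (orbit f ` (A - {j}))"
  proof (rule card_image, rule inj_onI)
    fix C D assume "C \<in> orbit f ` (A - {j})" "D \<in> orbit f ` (A - {j})" "C - {j} = D - {j}"
    then obtain x y where "x \<noteq> j" and C: "C = orbit f x" and D: "D = orbit f y"
      and "orbit f x - {j} = orbit f y - {j}" by blast
    then have "x \<in> orbit f y" using self_in_orbit[OF f, of x] by auto
    then show "C = D" unfolding C D using orbit_eq_of_mem[OF f] by simp
  qed
  finally show ?thesis unfolding cycle_count_def A .
qed

lemma cycle_count_remove_fixed:
  assumes f: "f permutes A" "finite A" and j: "j \<in> A" "f j = j"
  shows "Suc (cycle_count (A - {j}) f) = cycle_count A f"
proof -
  have "orbit f j = {j}" using j by (simp add: orbit_eq_singleton_iff)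
  moreover have "{j} \<notin> orbit f ` (A - {j})"
    using self_in_orbit[OF f] by fastforce
  moreover have "A = insert j (A - {j})" using j by auto
  ultimately have "card (orbit f ` A) = Suc (card (orbit f ` (A - {j})))"
    using f(2) by (metis card_insert_disjoint finite_Diff finite_imageI image_insert)
  then show ?thesis by (simp add: cycle_count_def)
qed

lemma orbit_image:
  assumes "\<And>y. y \<in> A \<Longrightarrow> f y \<in> A" "\<And>y. y \<in> A \<Longrightarrow> g (h y) = h (f y)" "x \<in> A"
  shows "orbit g (h x) = h ` orbit f x"
proof -
  have "(g ^^ n) (h x) = h ((f ^^ n) x) \<and> (f ^^ n) x \<in> A" for n
    by (induction n) (use assms in auto)
  then show ?thesis by (auto simp: orbit_altdef)
qed

lemma cycle_count_image:
  assumes f: "f permutes A" and g: "\<And>y. y \<in> A \<Longrightarrow> g (h y) = h (f y)" and h: "inj_on h A"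
  shows "cycle_count (h ` A) g = cycle_count A f"
proof -
  have "orbit g ` h ` A = (`) h ` orbit f ` A"
    unfolding image_image using assms by (intro image_cong orbit_image) (auto simp: permutes_in_image)
  also have "card \<dots> = card (orbit f ` A)"
  proof (rule card_image, rule inj_on_subset[OF inj_on_image_Pow[OF h]])
    show "orbit f ` A \<subseteq> Pow A" using permutes_orbit_subset[OF f] by auto
  qed
  finally show ?thesis unfolding cycle_count_def .
qed

section \<open>Derangements and the excess of their cycle lengths over two\<close>

locale derangement =
  fixes A :: "'a set" and f :: "'a \<Rightarrow> 'a"
  assumes perm: "f permutes A" and fin: "finite A" and no_fix: "\<And>x. x \<in> A \<Longrightarrow> f x \<noteq> x"
begin

text \<open>Without fixed points, failing \<open>f (f x) = x\<close> means lying on a cycle of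
  length at least three.\<close>

definition long :: "'a set" where
  "long = {x \<in> A. f (f x) \<noteq> x}"

definition long_orbits :: "'a set set" where
  "long_orbits = {C \<in> orbit f ` A. 3 \<le> card C}"

lemma f_inj: "f x = f y \<longleftrightarrow> x = y"
  using permutes_inj[OF perm] by (auto dest: injD)

lemma finite_orbit_f [simp]: "finite (orbit f x)"
  by (rule finite_orbit) (rule self_in_orbit[OF perm fin])

lemma card_orbit_ge2: "x \<in> A \<Longrightarrow> 2 \<le> card (orbit f x)"
proof -
  assume x: "x \<in> A"
  have "{x, f x} \<subseteq> orbit f x"
    using self_in_orbit[OF perm fin] orbit.base[of f] by auto
  then have "card {x, f x} \<le> card (orbit f x)" by (rule card_mono[rotated]) simp
  then show ?thesis using no_fix[OF x] by auto
qed

lemma card_orbit_ge3_iff: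
  assumes x: "x \<in> A"
  shows "3 \<le> card (orbit f x) \<longleftrightarrow> f (f x) \<noteq> x"
proof
  assume "3 \<le> card (orbit f x)"
  then show "f (f x) \<noteq> x"
  proof (rule contrapos_pn)
    assume "f (f x) = x"
    then have "orbit f x = {(f ^^ m) x | m. m < 2}"
      by (intro orbit_altdef_bounded) (auto simp: numeral_2_eq_2)
    also have "\<dots> = {x, f x}" by (auto simp: numeral_2_eq_2 less_Suc_eq intro: exI[of _ 0] exI[of _ 1])
    finally show "\<not> 3 \<le> card (orbit f x)" by (simp add: card_insert_if)
  qed
next
  assume *: "f (f x) \<noteq> x"
  have "{x, f x, f (f x)} \<subseteq> orbit f x"
    using self_in_orbit[OF perm fin, of x] orbit.base[of f x] orbit.step[of "f x" f x] by auto
  then have "card {x, f x, f (f x)} \<le> card (orbit f x)" by (rule card_mono[rotated]) simp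
  then show "3 \<le> card (orbit f x)" using no_fix[OF x] * f_inj by (auto simp: card_insert_if)
qed

lemma card_orbit_eq3_iff:
  assumes x: "x \<in> A" "f (f x) \<noteq> x"
  shows "card (orbit f x) = 3 \<longleftrightarrow> f (f (f x)) = x"
proof
  have d: "card {x, f x, f (f x)} = 3"
    using x no_fix[OF x(1)] f_inj by (auto simp: card_insert_if)
  have sub: "{x, f x, f (f x)} \<subseteq> orbit f x"
    using self_in_orbit[OF perm fin, of x] orbit.base[of f x] orbit.step[of "f x" f x] by auto
  {
    assume "card (orbit f x) = 3"
    then have "{x, f x, f (f x)} = orbit f x"
      using d sub by (intro card_subset_eq) auto
    moreover have "f (f (f x)) \<in> orbit f x" by (intro orbit.intros)
    ultimately have "f (f (f x)) \<in> {x, f x, f (f x)}" by simp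
    then show "f (f (f x)) = x"
      using x no_fix[OF x(1)] by (simp add: f_inj)
  next
    assume "f (f (f x)) = x"
    then have "orbit f x = {(f ^^ m) x | m. m < 3}"
      by (intro orbit_altdef_bounded) (auto simp: numeral_3_eq_3)
    also have "\<dots> = {x, f x, f (f x)}"
      by (auto simp: numeral_3_eq_3 less_Suc_eq intro: exI[of _ 0] exI[of _ 1] exI[of _ "Suc (Suc 0)"])
    finally show "card (orbit f x) = 3" using d by simp
  }
qed

lemma disjoint_orbits: "disjoint (orbit f ` A)"
proof (rule disjointI)
  fix C D assume "C \<in> orbit f ` A" "D \<in> orbit f ` A" "C \<noteq> D"
  then show "C \<inter> D = {}"
    using orbit_eq_of_mem[OF perm fin] by (auto; metis)
qed

lemma long_eq: "long = \<Union>long_orbits"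
proof
  show "long \<subseteq> \<Union>long_orbits"
    using card_orbit_ge3_iff self_in_orbit[OF perm fin] by (fastforce simp: long_def long_orbits_def)
  show "\<Union>long_orbits \<subseteq> long"
  proof
    fix y assume "y \<in> \<Union>long_orbits"
    then obtain x where x: "x \<in> A" "y \<in> orbit f x" "3 \<le> card (orbit f x)"
      by (auto simp: long_orbits_def)
    moreover have "y \<in> A" using permutes_orbit_subset[OF perm] x by auto
    moreover have "orbit f y = orbit f x" using x orbit_eq_of_mem[OF perm fin] by simp
    ultimately show "y \<in> long" using card_orbit_ge3_iff[of y] by (simp add: long_def)
  qed
qed

lemma finite_long_orbits: "finite long_orbits"
  using fin by (simp add: long_orbits_def)

lemma card_long: "card long = (\<Sum>C\<in>long_orbits. card C - 2) + 2 * card long_orbits"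
proof -
  have "card long = (\<Sum>C\<in>long_orbits. card C)"
    unfolding long_eq
  proof (rule card_Union_disjoint)
    show "disjoint long_orbits"
      by (rule pairwise_subset[OF disjoint_orbits]) (auto simp: long_orbits_def)
  qed (auto simp: long_orbits_def)
  also have "\<dots> = (\<Sum>C\<in>long_orbits. (card C - 2) + 2)"
    by (rule sum.cong) (auto simp: long_orbits_def)
  finally show ?thesis by (simp only: sum.distrib sum_constant of_nat_id mult.commute)
qed

text \<open>A cycle C has excess \<open>card C - 2\<close>. Cycles of length two contribute nothing,
  so the sum over \<open>long_orbits\<close> is the total excess
  \<open>card A - 2 * cycle_count A f\<close>, the quantity that the genus equation
  controls.\<close>

lemma card_eq_excess: "card A = (\<Sum>C\<in>long_orbits. card C - 2) + 2 * cycle_count A f"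
proof -
  have "card A = card (\<Union>(orbit f ` A))"
    using permutes_orbit_subset[OF perm] self_in_orbit[OF perm fin] by (intro arg_cong[of _ _ card]) blast
  also have "\<dots> = (\<Sum>C\<in>orbit f ` A. card C)"
    by (rule card_Union_disjoint[OF disjoint_orbits]) auto
  also have "\<dots> = (\<Sum>C\<in>orbit f ` A. (card C - 2) + 2)"
    by (rule sum.cong) (auto dest!: card_orbit_ge2)
  also have "\<dots> = (\<Sum>C\<in>orbit f ` A. card C - 2) + 2 * cycle_count A f"
    by (simp only: sum.distrib sum_constant of_nat_id cycle_count_def mult.commute)
  also have "(\<Sum>C\<in>orbit f ` A. card C - 2) = (\<Sum>C\<in>long_orbits. card C - 2)"
    using fin by (intro sum.mono_neutral_right) (auto simp: long_orbits_def)
  finally show ?thesis .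
qed

lemma card_long_orbits_le: "card long_orbits \<le> (\<Sum>C\<in>long_orbits. card C - 2)"
proof -
  have "(\<Sum>C\<in>long_orbits. 1) \<le> (\<Sum>C\<in>long_orbits. card C - 2)"
    by (rule sum_mono) (auto simp: long_orbits_def)
  then show ?thesis by simp
qed

lemma cycle_count_le: "2 * cycle_count A f \<le> card A"
  using card_eq_excess by simp

text \<open>A long cycle of excess e has e + 2 points, and e + 2 is at most 3e because e is at least
  1.\<close>

lemma card_long_le: "card long \<le> 3 * (card A - 2 * cycle_count A f)"
  using card_eq_excess card_long card_long_orbits_le by simp

lemma long_empty_iff: "long = {} \<longleftrightarrow> card A = 2 * cycle_count A f"
proof
  assume "long = {}"
  then show "card A = 2 * cycle_count A f" using card_long card_eq_excess by simp
next
  assume "card A = 2 * cycle_count A f"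
  then have "card long = 0" using card_long_le by simp
  then show "long = {}" using fin by (auto simp: long_def)
qed

text \<open>Total excess two means one 4-cycle or two 3-cycles. Four long points can only form a
  4-cycle, but six could also form a 6-cycle; the condition on the third iterate rules that
  out.\<close>

lemma excess_two_iff:
  "card A = 2 * cycle_count A f + 2 \<longleftrightarrow>
     card long = 4 \<or> card long = 6 \<and> (\<forall>x\<in>long. f (f (f x)) = x)"
proof -
  define e where "e = (\<Sum>C\<in>long_orbits. card C - 2)"
  have cube: "(\<forall>x\<in>long. f (f (f x)) = x) \<longleftrightarrow> (\<forall>C\<in>long_orbits. card C = 3)"
    using card_orbit_eq3_iff card_orbit_ge3_iff
    by (auto simp: long_def long_orbits_def)
  have long: "card long = e + 2 * card long_orbits" and le: "card long_orbits \<le> e"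
    using card_long card_long_orbits_le by (simp_all add: e_def)
  have "e = 2 \<longleftrightarrow> card long = 4 \<or> card long = 6 \<and> (\<forall>C\<in>long_orbits. card C = 3)"
  proof
    assume e: "e = 2"
    then consider "card long_orbits = 0" | "card long_orbits = 1" | "card long_orbits = 2"
      using le by linarith
    then show "card long = 4 \<or> card long = 6 \<and> (\<forall>C\<in>long_orbits. card C = 3)"
    proof cases
      case 1
      then have "long_orbits = {}" using finite_long_orbits by simp
      then have "e = 0" by (simp add: e_def)
      then show ?thesis using e by simp
    next
      case 2
      then show ?thesis using long e by simp
    next
      case 3
      then obtain C D where CD: "long_orbits = {C, D}" "C \<noteq> D" by (auto simp: card_2_iff)
      then have "(card C - 2) + (card D - 2) = 2" "3 \<le> card C" "3 \<le> card D"
        using e by (auto simp: e_def long_orbits_def)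
      then show ?thesis using CD long e 3 by auto
    qed
  next
    assume "card long = 4 \<or> card long = 6 \<and> (\<forall>C\<in>long_orbits. card C = 3)"
    then show "e = 2"
    proof
      assume "card long = 4"
      moreover from this have "long_orbits \<noteq> {}" using long_eq by auto
      then have "card long_orbits \<noteq> 0" using finite_long_orbits by simp
      ultimately show "e = 2" using long le by linarith
    next
      assume *: "card long = 6 \<and> (\<forall>C\<in>long_orbits. card C = 3)"
      then have "e = card long_orbits" by (simp add: e_def)
      then show "e = 2" using * long by simp
    qed
  qed
  then show ?thesis
    using card_eq_excess cube by (auto simp: e_def)
qed

end

section \<open>The permutation of a partition\<close>

text \<open>Describing the cycle of a block by the order alone, instead of by a sorted list, makes
  the effect of deleting a point or relabelling increasingly easy to follow.\<close>

definition csucc :: "nat set \<Rightarrow> nat \<Rightarrow> nat" where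
  "csucc B i = (if \<exists>j\<in>B. i < j then LEAST j. j \<in> B \<and> i < j else LEAST j. j \<in> B)"

lemma csucc_eqI:
  assumes "k \<in> B" "i < k" "\<And>j. j \<in> B \<Longrightarrow> i < j \<Longrightarrow> k \<le> j"
  shows "csucc B i = k"
  unfolding csucc_def using assms by (auto intro!: Least_equality)

lemma csucc_eqI_wrap:
  assumes "k \<in> B" "\<And>j. j \<in> B \<Longrightarrow> j \<le> i" "\<And>j. j \<in> B \<Longrightarrow> k \<le> j"
  shows "csucc B i = k"
  unfolding csucc_def using assms by (force intro!: Least_equality)

lemma csucc_cases [consumes 1]:
  assumes "B \<noteq> {}"
  obtains (up) "csucc B i \<in> B" "i < csucc B i" "\<And>j. j \<in> B \<Longrightarrow> i < j \<Longrightarrow> csucc B i \<le> j"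
  | (wrap) "csucc B i \<in> B" "\<And>j. j \<in> B \<Longrightarrow> j \<le> i" "\<And>j. j \<in> B \<Longrightarrow> csucc B i \<le> j"
proof (cases "\<exists>j\<in>B. i < j")
  case True
  then have "csucc B i = (LEAST j. j \<in> B \<and> i < j)" by (simp add: csucc_def)
  moreover have "(LEAST j. j \<in> B \<and> i < j) \<in> B \<and> i < (LEAST j. j \<in> B \<and> i < j)"
    using True by (intro LeastI_ex[of "\<lambda>j. j \<in> B \<and> i < j"]) blast
  ultimately show ?thesis using up by (auto intro: Least_le)
next
  case False
  then have "csucc B i = (LEAST j. j \<in> B)" by (simp add: csucc_def)
  moreover have "(LEAST j. j \<in> B) \<in> B"
    using assms by (intro LeastI_ex[of "\<lambda>j. j \<in> B"]) blast
  ultimately show ?thesis using wrap False by (metis Least_le not_le)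
qed

lemma csucc_mem: "B \<noteq> {} \<Longrightarrow> csucc B i \<in> B"
  by (erule csucc_cases[of B i]) auto

lemma csucc_inj:
  assumes "i \<in> B" "j \<in> B" "csucc B i = csucc B j"
  shows "i = j"
proof -
  have "False" if "i < j" "i \<in> B" "j \<in> B" "csucc B i = csucc B j" for i j
  proof -
    have ne: "B \<noteq> {}" using that by auto
    show False
      using ne
    proof (cases rule: csucc_cases[of _ i])
      case up
      then have le: "csucc B i \<le> j" "i < csucc B i" using that by auto
      show False
        using ne by (cases rule: csucc_cases[of _ j]) (use le that in force)+
    next
      case wrap
      then show False using that by force
    qed
  qed
  then show ?thesis using assms by (metis linorder_neqE_nat)
qed

lemma csucc_eq_self_iff:
  assumes "i \<in> B"
  shows "csucc B i = i \<longleftrightarrow> B = {i}"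
proof
  assume i: "csucc B i = i"
  have ne: "B \<noteq> {}" using assms by auto
  show "B = {i}"
    using ne by (cases rule: csucc_cases[of _ i]) (use assms i in \<open>force+\<close>)
next
  assume "B = {i}"
  then show "csucc B i = i" using csucc_mem[of B i] by simp
qed

text \<open>The order version of removing \<open>j\<close> from its cycle: only the predecessor of
  \<open>j\<close> changes its image.\<close>

lemma csucc_remove:
  assumes j: "j \<in> B" and i: "i \<in> B" "i \<noteq> j"
  shows "csucc (B - {j}) i = (if csucc B i = j then csucc B j else csucc B i)"
proof -
  have ne: "B \<noteq> {}" using j by auto
  show ?thesis
  proof (cases "csucc B i = j")
    case False
    show ?thesis
      using ne
    proof (cases rule: csucc_cases[of _ i])
      case up
      then have "csucc (B - {j}) i = csucc B i" using False by (intro csucc_eqI) auto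
      then show ?thesis using False by simp
    next
      case wrap
      then have "csucc (B - {j}) i = csucc B i" using False by (intro csucc_eqI_wrap) auto
      then show ?thesis using False by simp
    qed
  next
    case ij: True
    have nj: "csucc B j \<noteq> j" using csucc_eq_self_iff[OF j] i by auto
    have "csucc (B - {j}) i = csucc B j"
      using ne
    proof (cases rule: csucc_cases[of _ i])
      case i_up: up
      show ?thesis
        using ne
      proof (cases rule: csucc_cases[of _ j])
        case up
        have "csucc B j \<le> k" if "k \<in> B - {j}" "i < k" for k
          using i_up(3)[of k] up(3)[of k] that ij by auto
        then show ?thesis using up i_up ij by (intro csucc_eqI) auto
      next
        case wrap
        have "k \<le> i" if "k \<in> B - {j}" for k
          using i_up(3)[of k] wrap(2)[of k] that ij by (cases "i < k") auto
        then show ?thesis using wrap nj by (intro csucc_eqI_wrap) auto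
      qed
    next
      case i_wrap: wrap
      show ?thesis
        using ne
      proof (cases rule: csucc_cases[of _ j])
        case up
        have "csucc B j \<le> k" if "k \<in> B - {j}" for k
          using i_wrap(3)[of k] up(3)[of k] that ij by auto
        then show ?thesis using up i_wrap by (intro csucc_eqI_wrap) auto
      next
        case wrap
        then show ?thesis using i_wrap(3)[OF i(1)] wrap(2)[OF i(1)] ij i(2) by simp
      qed
    qed
    then show ?thesis using ij by simp
  qed
qed

lemma csucc_subset:
  assumes "B \<subseteq> A" "csucc A j \<in> B"
  shows "csucc B j = csucc A j"
proof -
  have ne: "A \<noteq> {}" using assms by auto
  show ?thesis
    using ne
  proof (cases rule: csucc_cases[of _ j])
    case up
    then show ?thesis using assms by (intro csucc_eqI) auto
  next
    case wrap
    then show ?thesis using assms by (intro csucc_eqI_wrap) auto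
  qed
qed

lemma csucc_image:
  assumes h: "strict_mono_on A h" and B: "B \<subseteq> A" "i \<in> B"
  shows "csucc (h ` B) (h i) = h (csucc B i)"
proof -
  have ne: "B \<noteq> {}" using B by auto
  show ?thesis
    using ne
  proof (cases rule: csucc_cases[of _ i])
    case up
    then show ?thesis
      using B strict_mono_on_less[OF h] strict_mono_on_less_eq[OF h]
      by (intro csucc_eqI) (auto simp: subset_iff)
  next
    case wrap
    then show ?thesis
      using B strict_mono_on_less_eq[OF h]
      by (intro csucc_eqI_wrap) (auto simp: subset_iff)
  qed
qed

lemma csucc_interval:
  assumes "i \<in> {a..<b}"
  shows "csucc {a..<b} i = (if Suc i < b then Suc i else a)"
proof (cases "Suc i < b")
  case True
  then have "csucc {a..<b} i = Suc i" using assms by (intro csucc_eqI) auto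
  then show ?thesis using True by simp
next
  case False
  then have "csucc {a..<b} i = a" using assms by (intro csucc_eqI_wrap) auto
  then show ?thesis using False by simp
qed

definition block :: "nat set set \<Rightarrow> nat \<Rightarrow> nat set" where
  "block P i = (THE B. B \<in> P \<and> i \<in> B)"

definition part_perm :: "nat set set \<Rightarrow> nat \<Rightarrow> nat" where
  "part_perm P i = (if i \<in> \<Union>P then csucc (block P i) i else i)"

lemma block_eq:
  assumes "partition_on A P" "B \<in> P" "i \<in> B"
  shows "block P i = B"
  unfolding block_def using assms
  by (intro the_equality) (auto simp: partition_on_def dest: disjointD)

lemma block_mem:
  assumes "partition_on A P" "i \<in> A"
  shows "block P i \<in> P" "i \<in> block P i"
proof -
  obtain B where "B \<in> P" "i \<in> B" using assms by (auto simp: partition_on_def)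
  then show "block P i \<in> P" "i \<in> block P i" using block_eq[OF assms(1)] by auto
qed

lemma part_perm_eq:
  assumes "partition_on A P" "B \<in> P" "i \<in> B"
  shows "part_perm P i = csucc B i"
  using assms block_eq[OF assms] by (auto simp: part_perm_def)

lemma part_perm_outside: "partition_on A P \<Longrightarrow> i \<notin> A \<Longrightarrow> part_perm P i = i"
  by (auto simp: part_perm_def partition_on_def)

lemma part_perm_mem_block:
  assumes "partition_on A P" "B \<in> P" "i \<in> B"
  shows "part_perm P i \<in> B"
  using part_perm_eq[OF assms] csucc_mem[of B i] assms(3) by auto

lemma part_perm_mem:
  assumes "partition_on A P" "i \<in> A"
  shows "part_perm P i \<in> A"
  using part_perm_mem_block[OF assms(1) block_mem[OF assms]] block_mem(1)[OF assms] assms(1)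
  by (auto simp: partition_on_def)

lemma part_perm_permutes:
  assumes P: "partition_on A P" and A: "finite A"
  shows "part_perm P permutes A"
proof (rule bij_imp_permutes)
  have "inj_on (part_perm P) A"
  proof (rule inj_onI)
    fix i j assume ij: "i \<in> A" "j \<in> A" "part_perm P i = part_perm P j"
    note i = block_mem[OF P ij(1)] and j = block_mem[OF P ij(2)]
    have "block P i = block P j"
      using part_perm_mem_block[OF P i] part_perm_mem_block[OF P j] ij(3) i(1) j(1) block_eq[OF P]
      by metis
    then show "i = j"
      using ij(3) part_perm_eq[OF P i] part_perm_eq[OF P j] i j by (auto intro: csucc_inj)
  qed
  then show "bij_betw (part_perm P) A A"
    using A part_perm_mem[OF P] by (simp add: bij_betw_def endo_inj_surj image_subsetI)
qed (rule part_perm_outside[OF P])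

lemma part_perm_eq_self_iff:
  assumes "partition_on A P" "i \<in> A"
  shows "part_perm P i = i \<longleftrightarrow> {i} \<in> P"
  using block_mem[OF assms] part_perm_eq[OF assms(1)] csucc_eq_self_iff block_eq[OF assms(1), of "{i}" i]
  by fastforce

text \<open>The one-block partition supplies the rotation zeta on every finite nonempty ground set,
  so that deleting a point treats alpha and zeta alike.\<close>

lemma part_perm_whole: "part_perm {A} i = (if i \<in> A then csucc A i else i)"
  by (auto simp: part_perm_def block_def intro!: arg_cong2[of _ _ _ _ csucc] the_equality)

lemma part_perm_whole_permutes:
  assumes "finite A"
  shows "part_perm {A} permutes A"
\<comment> \<open>For empty \<open>A\<close> the set \<open>{A}\<close> is not a partition, its only
  block being empty.\<close>
proof (cases "A = {}")
  case True
  then show ?thesis by (auto simp: part_perm_whole permutes_def)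
qed (simp add: part_perm_permutes partition_on_space assms)

lemma partition_on_remove:
  assumes "partition_on A P" "B \<in> P" "j \<in> B" "B \<noteq> {j}"
  shows "partition_on (A - {j}) (insert (B - {j}) (P - {B}))"
proof (rule partition_onI)
  have disj: "C \<inter> D = {}" if "C \<in> P" "D \<in> P" "C \<noteq> D" for C D
    using assms that by (auto simp: partition_on_def dest: disjointD)
  show "\<Union>(insert (B - {j}) (P - {B})) = A - {j}"
    using assms disj[of B] by (auto simp: partition_on_def)
  show "disjnt C D" if "C \<in> insert (B - {j}) (P - {B})" "D \<in> insert (B - {j}) (P - {B})" "C \<noteq> D" for C D
    using that disj assms(2) by (auto simp: disjnt_def)
  show "{} \<notin> insert (B - {j}) (P - {B})"
    using assms by (auto simp: partition_on_def)
qed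

lemma part_perm_remove:
  assumes P: "partition_on A P" and A: "finite A" and B: "B \<in> P" "j \<in> B" "B \<noteq> {j}"
  shows "part_perm (insert (B - {j}) (P - {B})) = transpose j (part_perm P j) \<circ> part_perm P"
proof
  fix i
  let ?P' = "insert (B - {j}) (P - {B})" and ?f = "part_perm P"
  note P' = partition_on_remove[OF P B]
  have inj: "?f x = ?f y \<longleftrightarrow> x = y" for x y
    using permutes_inj[OF part_perm_permutes[OF P A]] by (auto dest: injD)
  have jA: "j \<in> A" using P B by (auto simp: partition_on_def)
  show "part_perm ?P' i = (transpose j (?f j) \<circ> ?f) i"
  proof (cases "i \<in> A - {j}")
    case False
    then consider "i = j" | "i \<notin> A" by blast
    then have "(transpose j (?f j) \<circ> ?f) i = i"
    proof cases
      case 2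
      then show ?thesis
        using part_perm_outside[OF P] part_perm_mem[OF P jA] jA by (auto simp: transpose_def)
    qed simp
    then show ?thesis using part_perm_outside[OF P' False] by simp
  next
    case True
    then have i: "i \<in> A" "i \<noteq> j" by auto
    show ?thesis
    proof (cases "i \<in> B")
      case True
      then show ?thesis
        using part_perm_eq[OF P', of "B - {j}" i] part_perm_eq[OF P B(1)] B(2) csucc_remove[OF B(2) True i(2)]
          csucc_inj[OF True B(2)] i by (auto simp: transpose_def)
    next
      case False
      let ?C = "block P i"
      have C: "?C \<in> P" "i \<in> ?C" using block_mem[OF P i(1)] by auto
      have "?f i \<in> ?C" using part_perm_mem_block[OF P C] .
      moreover have "j \<notin> ?C" using False C B block_eq[OF P] by metis
      ultimately have "?f i \<noteq> j" by auto
      moreover have "part_perm ?P' i = ?f i"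
        using part_perm_eq[OF P', of ?C i] part_perm_eq[OF P C] C False by auto
      ultimately show ?thesis using i inj by (auto simp: transpose_def)
    qed
  qed
qed

lemma part_perm_remove_singleton:
  assumes P: "partition_on A P" and j: "{j} \<in> P"
  shows "part_perm (P - {{j}}) = part_perm P" "partition_on (A - {j}) (P - {{j}})"
proof -
  have disj: "C \<inter> D = {}" if "C \<in> P" "D \<in> P" "C \<noteq> D" for C D
    using P that by (auto simp: partition_on_def dest: disjointD)
  show P': "partition_on (A - {j}) (P - {{j}})"
    using P disj[OF j] by (intro partition_onI) (auto simp: partition_on_def disjnt_def dest: disjointD)
  show "part_perm (P - {{j}}) = part_perm P"
  proof
    fix i
    show "part_perm (P - {{j}}) i = part_perm P i"
    proof (cases "i \<in> A - {j}")
      case True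
      then have "block P i \<in> P - {{j}}" "i \<in> block P i" using block_mem[OF P, of i] by auto
      then show ?thesis using part_perm_eq[OF P', of "block P i" i] part_perm_eq[OF P, of "block P i" i] by simp
    next
      case False
      then show ?thesis
        using part_perm_outside[OF P' False] part_perm_outside[OF P, of i] part_perm_eq_self_iff[OF P, of j] j P
        by (cases "i \<in> A") (auto simp: partition_on_def)
    qed
  qed
qed

section \<open>Words of marked points\<close>

text \<open>A pair \<open>(S, T)\<close> encodes a word with letters \<open>S\<close>, \<open>T\<close> and ``unmarked'' in which no \<open>T\<close> is
  immediately followed by an \<open>S\<close>. The flag \<open>b\<close> forbids a leading \<open>S\<close>, as if a \<open>T\<close> preceded the
  word; \<open>open_words\<close> are those that may be continued by an \<open>S\<close>.\<close>

definition words :: "bool \<Rightarrow> nat \<Rightarrow> (nat set \<times> nat set) set" where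
  "words b n = {(S, T). S \<subseteq> {..<n} \<and> T \<subseteq> {..<n} \<and> S \<inter> T = {} \<and> Suc ` T \<inter> S = {} \<and> (b \<longrightarrow> 0 \<notin> S)}"

definition open_words :: "bool \<Rightarrow> nat \<Rightarrow> (nat set \<times> nat set) set" where
  "open_words b n = {(S, T) \<in> words b n. n \<notin> Suc ` T \<and> (b \<longrightarrow> n \<noteq> 0)}"

text \<open>A term of the inclusion-exclusion: a sign for every marked point, a factor
  \<open>y\<close> for every singleton block deleted with S, and \<open>p\<close> at the number of
  points that remain.\<close>

definition word_weight :: "'a::comm_ring_1 \<Rightarrow> (nat \<Rightarrow> 'a) \<Rightarrow> nat \<Rightarrow> nat set \<times> nat set \<Rightarrow> 'a" where
  "word_weight y p n = (\<lambda>(S, T). (- y) ^ card S * (- 1) ^ card T * p (n - card S - card T))"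

lemma finite_words [simp]: "finite (words b n)"
  by (rule finite_subset[of _ "Pow {..<n} \<times> Pow {..<n}"]) (auto simp: words_def)

lemma finite_open_words [simp]: "finite (open_words b n)"
  by (rule finite_subset[OF _ finite_words[of b n]]) (auto simp: open_words_def)

lemma words_finiteD: "(S, T) \<in> words b n \<Longrightarrow> finite S \<and> finite T"
  by (auto simp: words_def intro: finite_subset)

lemma words_card_le:
  assumes "(S, T) \<in> words b n"
  shows "card S + card T \<le> n"
proof -
  have "card S + card T = card (S \<union> T)"
    using assms words_finiteD[OF assms] by (intro card_Un_disjoint[symmetric]) (auto simp: words_def)
  also have "\<dots> \<le> card {..<n}"
    using assms by (intro card_mono) (auto simp: words_def)
  finally show ?thesis by simp
qed

text \<open>Split by whether the last letter is T; a T may be appended to any word.\<close>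

lemma words_Suc:
  "words b (Suc n) = open_words b (Suc n) \<union> (\<lambda>(S, T). (S, insert n T)) ` words b n"
  (is "?L = ?O \<union> ?I")
proof (intro equalityI subsetI)
  fix w assume w: "w \<in> ?L"
  obtain S T where ST: "w = (S, T)" by fastforce
  show "w \<in> ?O \<union> ?I"
  proof (cases "n \<in> T")
    case True
    then have "(S, T - {n}) \<in> words b n" "w = (\<lambda>(S, T). (S, insert n T)) (S, T - {n})"
      using w unfolding ST words_def by (auto simp: less_Suc_eq subset_iff)
    then show ?thesis by blast
  qed (use w in \<open>auto simp: ST open_words_def\<close>)
next
  fix w assume "w \<in> ?O \<union> ?I"
  then show "w \<in> ?L" by (auto simp: open_words_def words_def less_Suc_eq subset_iff)
qed

text \<open>A word whose last letter is not T ends in an unmarked letter, after any word, or in S,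
  after an open word.\<close>

lemma open_words_Suc:
  "open_words b (Suc n) = words b n \<union> (\<lambda>(S, T). (insert n S, T)) ` open_words b n"
  (is "?L = ?O \<union> ?I")
proof (intro equalityI subsetI)
  fix w assume w: "w \<in> ?L"
  obtain S T where ST: "w = (S, T)" by fastforce
  show "w \<in> ?O \<union> ?I"
  proof (cases "n \<in> S")
    case True
    then have "(S - {n}, T) \<in> open_words b n" "w = (\<lambda>(S, T). (insert n S, T)) (S - {n}, T)"
      using w unfolding ST words_def open_words_def by (auto simp: less_Suc_eq subset_iff)
    then show ?thesis by blast
  next
    case False
    then have "w \<in> words b n"
      using w unfolding ST words_def open_words_def by (auto simp: less_Suc_eq subset_iff)
    then show ?thesis by blast
  qed
next
  fix w assume "w \<in> ?O \<union> ?I"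
  then show "w \<in> ?L" by (auto simp: open_words_def words_def less_Suc_eq subset_iff)
qed

lemma sum_words_insert_snd:
  "sum (word_weight y p (Suc n)) ((\<lambda>(S, T). (S, insert n T)) ` words b n)
     = - sum (word_weight y p n) (words b n)"
  unfolding sum_negf[symmetric]
proof (subst sum.reindex)
  show "inj_on (\<lambda>(S, T). (S, insert n T)) (words b n)"
    by (rule inj_onI) (auto simp: words_def insert_eq_iff subset_iff)
  show "sum (word_weight y p (Suc n) \<circ> (\<lambda>(S, T). (S, insert n T))) (words b n)
      = (\<Sum>w\<in>words b n. - word_weight y p n w)"
  proof (rule sum.cong)
    fix w assume w: "w \<in> words b n"
    obtain S T where ST: "w = (S, T)" by fastforce
    have "n \<notin> T" "finite T" using w words_finiteD[of S T] by (auto simp: ST words_def)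
    then show "(word_weight y p (Suc n) \<circ> (\<lambda>(S, T). (S, insert n T))) w = - word_weight y p n w"
      by (simp add: ST word_weight_def Suc_diff_le)
  qed simp
qed

lemma sum_words_Suc:
  "sum (word_weight y p (Suc n)) (words b (Suc n))
     = sum (word_weight y p (Suc n)) (open_words b (Suc n)) - sum (word_weight y p n) (words b n)"
  unfolding words_Suc[of b n]
  by (subst sum.union_disjoint[OF finite_open_words]) (auto simp: sum_words_insert_snd open_words_def)

lemma sum_open_words_Suc:
  "sum (word_weight y p (Suc n)) (open_words b (Suc n))
     = sum (word_weight y (\<lambda>m. p (Suc m)) n) (words b n) - y * sum (word_weight y p n) (open_words b n)"
proof -
  have "sum (word_weight y p (Suc n)) ((\<lambda>(S, T). (insert n S, T)) ` open_words b n)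
      = (\<Sum>w\<in>open_words b n. - y * word_weight y p n w)"
  proof (subst sum.reindex)
    show "inj_on (\<lambda>(S, T). (insert n S, T)) (open_words b n)"
      by (rule inj_onI) (auto simp: words_def open_words_def insert_eq_iff subset_iff)
    show "sum (word_weight y p (Suc n) \<circ> (\<lambda>(S, T). (insert n S, T))) (open_words b n)
        = (\<Sum>w\<in>open_words b n. - y * word_weight y p n w)"
    proof (rule sum.cong)
      fix w assume w: "w \<in> open_words b n"
      obtain S T where ST: "w = (S, T)" by fastforce
      have "n \<notin> S" "finite S" using w words_finiteD[of S T] by (auto simp: ST words_def open_words_def)
      then show "(word_weight y p (Suc n) \<circ> (\<lambda>(S, T). (insert n S, T))) w = - y * word_weight y p n w"
        by (simp add: ST word_weight_def algebra_simps)
    qed simp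
  qed
  moreover have "sum (word_weight y p (Suc n)) (words b n)
      = sum (word_weight y (\<lambda>m. p (Suc m)) n) (words b n)"
  proof (rule sum.cong)
    fix w assume w: "w \<in> words b n"
    obtain S T where ST: "w = (S, T)" by fastforce
    have "Suc n - card S - card T = Suc (n - card S - card T)"
      using words_card_le[of S T b n] w by (simp add: ST Suc_diff_le)
    then show "word_weight y p (Suc n) w = word_weight y (\<lambda>m. p (Suc m)) n w"
      by (simp add: ST word_weight_def)
  qed simp
  ultimately show ?thesis
    unfolding open_words_Suc[of b n]
    by (subst sum.union_disjoint[OF finite_words]) (auto simp: sum_distrib_left[symmetric] sum_negf words_def)
qed

section \<open>Generating functions of words\<close>

definition words_gf :: "'a::comm_ring_1 \<Rightarrow> bool \<Rightarrow> (nat \<Rightarrow> 'a) \<Rightarrow> 'a fps" where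
  "words_gf y b p = Abs_fps (\<lambda>n. sum (word_weight y p n) (words b n))"

definition open_words_gf :: "'a::comm_ring_1 \<Rightarrow> bool \<Rightarrow> (nat \<Rightarrow> 'a) \<Rightarrow> 'a fps" where
  "open_words_gf y b p = Abs_fps (\<lambda>n. sum (word_weight y p n) (open_words b n))"

lemma words_0: "words b 0 = {({}, {})}"
  by (auto simp: words_def)

lemma open_words_0: "open_words b 0 = (if b then {} else {({}, {})})"
  by (auto simp: words_def open_words_def)

text \<open>The constant accounts for the empty word: with \<open>b\<close> set it belongs to
  \<open>words\<close> but not to \<open>open_words\<close>.\<close>

lemma words_gf_rec:
  "(1 + fps_X) * words_gf y b p = open_words_gf y b p + (if b then fps_const (p 0) else 0)"
proof (rule fps_ext)
  fix n
  show "fps_nth ((1 + fps_X) * words_gf y b p) n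
    = fps_nth (open_words_gf y b p + (if b then fps_const (p 0) else 0)) n"
    by (cases n; simp add: words_gf_def open_words_gf_def distrib_right sum_words_Suc)
      (auto simp: words_0 open_words_0 word_weight_def)
qed

text \<open>The shift of \<open>p\<close> comes from an appended unmarked letter, which raises the
  number of remaining points by one.\<close>

lemma open_words_gf_rec:
  "(1 + fps_const y * fps_X) * open_words_gf y b p
     = (if b then 0 else fps_const (p 0)) + fps_X * words_gf y b (\<lambda>m. p (Suc m))"
proof (rule fps_ext)
  fix n
  show "fps_nth ((1 + fps_const y * fps_X) * open_words_gf y b p) n
     = fps_nth ((if b then 0 else fps_const (p 0)) + fps_X * words_gf y b (\<lambda>m. p (Suc m))) n"
    by (cases n; simp add: words_gf_def open_words_gf_def distrib_right sum_open_words_Suc mult.assoc)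
      (auto simp: open_words_0 word_weight_def)
qed

lemma Abs_fps_shift_compose:
  fixes w :: "'a::idom fps"
  assumes "fps_nth w 0 = 0"
  shows "Abs_fps p oo w = fps_const (p 0) + w * (Abs_fps (\<lambda>m. p (Suc m)) oo w)"
proof -
  have *: "Abs_fps p = fps_const (p 0) + fps_X * Abs_fps (\<lambda>m. p (Suc m))"
  proof (rule fps_ext)
    fix n show "fps_nth (Abs_fps p) n = fps_nth (fps_const (p 0) + fps_X * Abs_fps (\<lambda>m. p (Suc m))) n"
      by (cases n) auto
  qed
  show ?thesis
    by (subst *) (simp add: fps_compose_add_distrib fps_compose_mult_distrib assms)
qed

text \<open>Both sides obey the same recursion when \<open>p\<close> is shifted by one. Multiplying
  their difference \<open>u p\<close> by \<open>D\<close> gives x times the difference for the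
  shifted \<open>p\<close>. As \<open>D\<close> has constant term 1, the n-th coefficient of
  \<open>u p\<close> is reduced to an earlier one of another \<open>u\<close>, so the induction on n
  runs over all \<open>p\<close> at once.\<close>

lemma words_gf_eq:
  fixes y :: "'a::idom"
  defines "D \<equiv> (1 + fps_X) * (1 + fps_const y * fps_X)"
  assumes w: "w * D = fps_X" "fps_nth w 0 = 0"
  shows "D * words_gf y b p = (if b then 1 + fps_const y * fps_X else 1) * (Abs_fps p oo w)"
proof -
  define c where "c = (if b then 1 + fps_const y * fps_X else 1 :: 'a fps)"
  define u where "u p = D * words_gf y b p - c * (Abs_fps p oo w)" for p
  have D1: "fps_nth D 0 = 1" by (simp add: D_def)
  have rec: "D * words_gf y b p = c * fps_const (p 0) + fps_X * words_gf y b (\<lambda>m. p (Suc m))" for p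
  proof -
    have "D * words_gf y b p = (1 + fps_const y * fps_X) * ((1 + fps_X) * words_gf y b p)"
      by (simp add: D_def mult_ac)
    also have "\<dots> = c * fps_const (p 0) + fps_X * words_gf y b (\<lambda>m. p (Suc m))"
      unfolding words_gf_rec distrib_left open_words_gf_rec by (simp add: c_def)
    finally show ?thesis .
  qed
  have urec: "D * u p = fps_X * u (\<lambda>m. p (Suc m))" for p
  proof -
    have "D * u p = D * (fps_X * words_gf y b (\<lambda>m. p (Suc m)))
        - c * (w * D) * (Abs_fps (\<lambda>m. p (Suc m)) oo w)"
      unfolding u_def rec Abs_fps_shift_compose[OF w(2), of p] by (simp add: algebra_simps)
    also have "\<dots> = fps_X * u (\<lambda>m. p (Suc m))"
      unfolding w(1) u_def by (simp add: algebra_simps)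
    finally show ?thesis .
  qed
  have "fps_nth (u p) n = 0" for n p
  proof (induction n arbitrary: p rule: less_induct)
    case (less n)
    have "fps_nth (D * u p) n = fps_nth (u p) n"
    proof -
      have "fps_nth (D * u p) n = (\<Sum>i=0..n. fps_nth D i * fps_nth (u p) (n - i))"
        by (simp add: fps_mult_nth)
      also have "\<dots> = (\<Sum>i\<in>{0}. fps_nth D i * fps_nth (u p) (n - i))"
        by (rule sum.mono_neutral_right) (auto simp: less)
      finally show ?thesis by (simp add: D1)
    qed
    moreover have "fps_nth (D * u p) n = 0"
      unfolding urec using less by (cases n) auto
    ultimately show ?case by simp
  qed
  then have "u p = 0" by (intro fps_ext) simp
  then show ?thesis by (simp add: u_def c_def)
qed

definition cyclic_words :: "nat \<Rightarrow> (nat set \<times> nat set) set" where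
  "cyclic_words n = {(S, T). S \<subseteq> {..<n} \<and> T \<subseteq> {..<n} \<and> S \<inter> T = {} \<and> (\<lambda>i. Suc i mod n) ` T \<inter> S = {}}"

text \<open>Cut the circle in front of 0. If the last point is not in T, the cut imposes nothing; if
  it is, the rest must not begin with S, which is what the flag \<open>True\<close> records.\<close>

lemma cyclic_words_Suc:
  "cyclic_words (Suc n) = open_words False (Suc n) \<union> (\<lambda>(S, T). (S, insert n T)) ` words True n"
  (is "?L = ?O \<union> ?I")
proof (intro equalityI subsetI)
  fix w assume w: "w \<in> ?L"
  obtain S T where ST: "w = (S, T)" by fastforce
  have S: "S \<subseteq> {..<Suc n}" and T: "T \<subseteq> {..<Suc n}" and disj: "S \<inter> T = {}"
    and not_in: "\<And>i. i \<in> T \<Longrightarrow> Suc i mod Suc n \<notin> S"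
    using w unfolding ST cyclic_words_def by blast+
  have Suc_in: "Suc i \<notin> S" if "i \<in> T" for i
  proof (cases "i = n")
    case False
    then have "Suc i mod Suc n = Suc i" using T that by auto
    then show ?thesis using not_in[OF that] by simp
  qed (use S in auto)
  show "w \<in> ?O \<union> ?I"
  proof (cases "n \<in> T")
    case True
    have "0 \<notin> S" using not_in[OF True] by simp
    then have "(S, T - {n}) \<in> words True n" "w = (\<lambda>(S, T). (S, insert n T)) (S, T - {n})"
      using S T disj True Suc_in unfolding ST words_def by (auto simp: less_Suc_eq subset_iff)
    then show ?thesis by blast
  next
    case False
    then show ?thesis
      using S T disj Suc_in unfolding ST open_words_def words_def by auto
  qed
next
  fix w assume w: "w \<in> ?O \<union> ?I"
  obtain S T where ST: "w = (S, T)" by fastforce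
  have S: "S \<subseteq> {..<Suc n}" and T: "T \<subseteq> {..<Suc n}" and disj: "S \<inter> T = {}"
    and Suc_in: "\<And>i. i \<in> T \<Longrightarrow> i \<noteq> n \<Longrightarrow> Suc i \<notin> S" and 0: "n \<in> T \<Longrightarrow> 0 \<notin> S"
    using w unfolding ST open_words_def words_def by auto
  have "Suc i mod Suc n \<notin> S" if "i \<in> T" for i
  proof (cases "i = n")
    case False
    then have "Suc i mod Suc n = Suc i" using T that by auto
    then show ?thesis using Suc_in[OF that False] by simp
  qed (use 0 that in simp)
  then show "w \<in> ?L" using S T disj unfolding ST cyclic_words_def by auto
qed

lemma finite_cyclic_words [simp]: "finite (cyclic_words n)"
  by (rule finite_subset[of _ "Pow {..<n} \<times> Pow {..<n}"]) (auto simp: cyclic_words_def)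

lemma sum_cyclic_words_Suc:
  "sum (word_weight y p (Suc n)) (cyclic_words (Suc n))
     = sum (word_weight y p (Suc n)) (open_words False (Suc n)) - sum (word_weight y p n) (words True n)"
  unfolding cyclic_words_Suc[of n]
  by (subst sum.union_disjoint[OF finite_open_words]) (auto simp: sum_words_insert_snd open_words_def)

text \<open>The factor on the right is (1 + x) - x (1 + xy): open words with a free start, minus
  words with restricted start that a final T closes off.\<close>

lemma cyclic_words_gf:
  fixes y :: "'a::idom"
  defines "D \<equiv> (1 + fps_X) * (1 + fps_const y * fps_X)"
  assumes w: "w * D = fps_X" "fps_nth w 0 = 0"
  shows "D * Abs_fps (\<lambda>n. sum (word_weight y p n) (cyclic_words n))
    = (1 - fps_const y * fps_X ^ 2) * (Abs_fps p oo w)"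
proof -
  have C: "Abs_fps (\<lambda>n. sum (word_weight y p n) (cyclic_words n))
      = open_words_gf y False p - fps_X * words_gf y True p"
  proof (rule fps_ext)
    fix n
    have "cyclic_words 0 = {({}, {})}" by (auto simp: cyclic_words_def)
    then show "fps_nth (Abs_fps (\<lambda>n. sum (word_weight y p n) (cyclic_words n))) n
      = fps_nth (open_words_gf y False p - fps_X * words_gf y True p) n"
      by (cases n) (auto simp: open_words_gf_def words_gf_def sum_cyclic_words_Suc open_words_0)
  qed
  have "D * Abs_fps (\<lambda>n. sum (word_weight y p n) (cyclic_words n))
      = (1 + fps_X) * (D * words_gf y False p) - fps_X * (D * words_gf y True p)"
    unfolding C using words_gf_rec[of y False p] by (simp add: algebra_simps)
  also have "\<dots> = (1 - fps_const y * fps_X ^ 2) * (Abs_fps p oo w)"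
    using words_gf_eq[OF w[unfolded D_def], folded D_def]
    by (simp add: algebra_simps power2_eq_square)
  finally show ?thesis .
qed

section \<open>Removing marked points from genus one partitions\<close>

text \<open>The genus equation for g = 1 with the subtraction moved across, over an arbitrary ground
  set because points are going to be deleted.\<close>

definition genus_one :: "nat set \<Rightarrow> nat set set set" where
  "genus_one A = {P. partition_on A P \<and>
     card A = cycle_count A (part_perm P) + cycle_count A (inv (part_perm P) \<circ> part_perm {A}) + 1}"

text \<open>Agreement of alpha with the rotation at \<open>i\<close> says that \<open>i\<close> is a
  fixed point of alpha^-1 zeta.\<close>

definition marked :: "nat set \<Rightarrow> nat set \<Rightarrow> nat set \<Rightarrow> nat set set set" where
  "marked A S T = {P \<in> genus_one A. (\<forall>i\<in>S. part_perm P i = i) \<and> (\<forall>i\<in>T. part_perm P i = part_perm {A} i)}"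

definition genus_one_poly :: "nat set \<Rightarrow> rat fps" where
  "genus_one_poly A = (\<Sum>P\<in>genus_one A. fps_X ^ card P)"

lemma finite_genus_one [simp]: "finite A \<Longrightarrow> finite (genus_one A)"
  unfolding genus_one_def by (rule finite_subset[OF _ finitely_many_partition_on[of A]]) auto

lemma cycle_count_pos: "finite A \<Longrightarrow> A \<noteq> {} \<Longrightarrow> 0 < cycle_count A f"
  by (auto simp: cycle_count_def card_gt_0_iff)

lemma genus_one_small:
  assumes "finite A" "card A \<le> 1"
  shows "genus_one A = {}"
proof (cases "A = {}")
  case False
  have "card A = cycle_count A f + cycle_count A g + 1 \<Longrightarrow> False" for f g
    using assms cycle_count_pos[OF assms(1) False, of f] by simp
  then show ?thesis unfolding genus_one_def by blast
qed (simp add: genus_one_def)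

lemma part_perm_whole_neq:
  assumes "finite A" "2 \<le> card A" "j \<in> A"
  shows "part_perm {A} j \<noteq> j" "part_perm {A} j \<in> A"
proof -
  have "A \<noteq> {j}" using assms by auto
  then show "part_perm {A} j \<noteq> j" using assms by (simp add: part_perm_whole csucc_eq_self_iff)
  show "part_perm {A} j \<in> A" using assms csucc_mem[of A j] by (auto simp: part_perm_whole)
qed

lemma part_perm_whole_remove:
  assumes "finite A" "2 \<le> card A" "j \<in> A"
  shows "part_perm {A - {j}} = transpose j (part_perm {A} j) \<circ> part_perm {A}"
proof -
  have "A \<noteq> {j}" "A \<noteq> {}" using assms by auto
  then show ?thesis
    using part_perm_remove[of A "{A}" A j] assms partition_on_space[of A] by simp
qed

text \<open>The number of points and z(alpha) both drop by one, while \<open>j\<close> lies on a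
  longer cycle of alpha^-1 zeta, whose number of cycles is therefore unchanged.\<close>

lemma genus_one_remove_singleton:
  assumes A: "finite A" "2 \<le> card A" and P: "partition_on A P" and j: "j \<in> A" "{j} \<in> P"
  shows "P - {{j}} \<in> genus_one (A - {j}) \<longleftrightarrow> P \<in> genus_one A"
proof -
  let ?f = "part_perm P" and ?z = "part_perm {A}"
  let ?g = "inv ?f \<circ> ?z"
  note f = part_perm_permutes[OF P A(1)] and z = part_perm_whole_permutes[OF A(1)]
  have fj: "?f j = j" using part_perm_eq_self_iff[OF P j(1)] j by simp
  have inv_fj: "inv ?f j = j" using fj permutes_inv_eq[OF f] by simp
  have g: "?g permutes A" using f z by (intro permutes_compose permutes_inv)
  have gj: "?g j \<noteq> j"
    using part_perm_whole_neq[OF A j(1)] fj by (metis comp_apply f permutes_inv_eq)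
  \<comment> \<open>\<open>inv ?f\<close> fixes \<open>j\<close>, so moving it past the
    transposition of \<open>j\<close> and \<open>?z j\<close> yields that of \<open>j\<close> and
    \<open>?g j\<close>: the point \<open>j\<close> is cut out of its cycle of
    \<open>?g\<close>.\<close>
  have "inv ?f \<circ> part_perm {A - {j}} = transpose j (?g j) \<circ> ?g"
  proof
    fix i
    have "inv ?f x = inv ?f y \<longleftrightarrow> x = y" for x y
      using permutes_inj[OF permutes_inv[OF f]] by (auto dest: injD)
    then have "inv ?f (transpose j (?z j) (?z i)) = transpose (inv ?f j) (inv ?f (?z j)) (inv ?f (?z i))"
      by (simp add: transpose_def)
    then show "(inv ?f \<circ> part_perm {A - {j}}) i = (transpose j (?g j) \<circ> ?g) i"
      using inv_fj by (simp add: part_perm_whole_remove[OF A j(1)])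
  qed
  then have 1: "cycle_count (A - {j}) (inv ?f \<circ> part_perm {A - {j}}) = cycle_count A ?g"
    by (simp only: cycle_count_remove[OF g A(1) j(1) gj])
  have 2: "Suc (cycle_count (A - {j}) ?f) = cycle_count A ?f"
    by (rule cycle_count_remove_fixed[OF f A(1) j(1) fj])
  have 3: "card A = Suc (card (A - {j}))" using A j(1) by (metis card_Suc_Diff1)
  show ?thesis
    using P part_perm_remove_singleton[OF P j(2)] 1 2 3 by (auto simp: genus_one_def)
qed

text \<open>Now \<open>j\<close> is a fixed point of alpha^-1 zeta and the roles are exchanged.
  Alpha and zeta are multiplied by the same transposition, which cancels in the quotient; so the
  quotient only loses a fixed point, while alpha keeps its number of cycles.\<close>

lemma genus_one_contract:
  assumes A: "finite A" "2 \<le> card A" and P: "partition_on A P" and j: "j \<in> B" "B \<in> P" "B \<noteq> {j}"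
    and fj: "part_perm P j = part_perm {A} j"
  shows "insert (B - {j}) (P - {B}) \<in> genus_one (A - {j}) \<longleftrightarrow> P \<in> genus_one A"
proof -
  let ?f = "part_perm P" and ?z = "part_perm {A}"
  let ?g = "inv ?f \<circ> ?z" and ?P' = "insert (B - {j}) (P - {B})"
  have jA: "j \<in> A" using P j by (auto simp: partition_on_def)
  note f = part_perm_permutes[OF P A(1)] and z = part_perm_whole_permutes[OF A(1)]
  have f': "part_perm ?P' = transpose j (?f j) \<circ> ?f" using part_perm_remove[OF P A(1) j(2,1,3)] .
  have z': "part_perm {A - {j}} = transpose j (?f j) \<circ> ?z" using part_perm_whole_remove[OF A jA] fj by simp
  have g: "?g permutes A" using f z by (intro permutes_compose permutes_inv)
  have gj: "?g j = j" using fj by (metis comp_apply f permutes_inv_eq)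
  have "inv (part_perm ?P') \<circ> part_perm {A - {j}} = ?g"
  proof -
    have "inv (part_perm ?P') = inv ?f \<circ> transpose j (?f j)"
      unfolding f' by (subst o_inv_distrib) (auto simp: permutes_bij[OF f])
    then show ?thesis unfolding z' by (auto simp: fun_eq_iff)
  qed
  moreover have "Suc (cycle_count (A - {j}) ?g) = cycle_count A ?g"
    by (rule cycle_count_remove_fixed[OF g A(1) jA gj])
  moreover have "cycle_count (A - {j}) (part_perm ?P') = cycle_count A ?f"
    unfolding f' using fj part_perm_whole_neq[OF A jA] by (intro cycle_count_remove[OF f A(1) jA]) simp
  moreover have "card A = Suc (card (A - {j}))" using A jA by (metis card_Suc_Diff1)
  ultimately show ?thesis
    using P partition_on_remove[OF P j(2,1,3)] by (auto simp: genus_one_def)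
qed

lemma marked_genus_oneD: "P \<in> marked A S T \<Longrightarrow> partition_on A P"
  by (simp add: marked_def genus_one_def)

lemma sum_marked_remove_singleton:
  assumes A: "finite A" and S: "S \<subseteq> A" and j: "j \<in> S"
  shows "(\<Sum>P\<in>marked A S {}. x ^ card P) = (x::'a::comm_semiring_1) * (\<Sum>P\<in>marked (A - {j}) (S - {j}) {}. x ^ card P)"
proof (cases "card A \<le> 1")
  case True
  then have "genus_one A = {}" "genus_one (A - {j}) = {}"
    using A by (auto intro!: genus_one_small simp: card_Diff_singleton_if)
  then show ?thesis by (simp add: marked_def)
next
  case False
  then have A2: "2 \<le> card A" and jA: "j \<in> A" using S j by auto
  have ins: "partition_on A (insert {j} P)" "{j} \<notin> P" if "partition_on (A - {j}) P" for P
  proof -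
    show "{j} \<notin> P" using that by (auto simp: partition_on_def)
    have "j \<notin> \<Union>P" using that by (auto simp: partition_on_def)
    then have "partition_on (insert j (A - {j})) (insert {j} P)"
      using that by (auto simp: partition_on_def disjoint_def)
    then show "partition_on A (insert {j} P)" using jA by (simp add: insert_absorb)
  qed
  have fin: "finite P" if "partition_on A P" for P
    using finite_elements[OF A that] .
  have "(\<Sum>P\<in>marked A S {}. x ^ card P) = (\<Sum>P\<in>marked (A - {j}) (S - {j}) {}. x * x ^ card P)"
  proof (rule sum.reindex_bij_witness[of _ "insert {j}" "\<lambda>P. P - {{j}}"])
    fix P assume P: "P \<in> marked A S {}"
    then have part: "partition_on A P" by (rule marked_genus_oneD)
    have jP: "{j} \<in> P" using P j part_perm_eq_self_iff[OF part jA] by (auto simp: marked_def)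
    show "insert {j} (P - {{j}}) = P" using jP by auto
    show "P - {{j}} \<in> marked (A - {j}) (S - {j}) {}"
      using P genus_one_remove_singleton[OF A A2 part jA jP] part_perm_remove_singleton(1)[OF part jP]
      by (auto simp: marked_def)
    show "x * x ^ card (P - {{j}}) = x ^ card P"
      using jP fin[OF part] by (metis card.remove power_Suc)
  next
    fix P assume P: "P \<in> marked (A - {j}) (S - {j}) {}"
    note part = ins[OF marked_genus_oneD[OF P]]
    have eq: "insert {j} P - {{j}} = P" using part(2) by auto
    then show "insert {j} P - {{j}} = P" .
    have jP: "{j} \<in> insert {j} P" by simp
    have "part_perm P = part_perm (insert {j} P)"
      using part_perm_remove_singleton(1)[OF part(1) jP] eq by simp
    moreover have "part_perm (insert {j} P) j = j"
      using part_perm_eq_self_iff[OF part(1) jA] by simp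
    moreover have "insert {j} P \<in> genus_one A"
      using genus_one_remove_singleton[OF A A2 part(1) jA jP] eq P by (simp add: marked_def)
    ultimately show "insert {j} P \<in> marked A S {}"
      using P by (auto simp: marked_def)
  qed
  then show ?thesis by (simp add: sum_distrib_left)
qed

text \<open>As alpha sends \<open>j\<close> to its neighbour s on the circle, \<open>j\<close> can
  be put back by inserting it into the block of s. Hence the deletion is a bijection, and it keeps
  the number of blocks. The hypotheses keep \<open>j\<close> and s out of \<open>S\<close>:
  contracting a block {j, s} would make s a new fixed point.\<close>

lemma sum_marked_contract:
  assumes A: "finite A" and ST: "S \<subseteq> A" "T \<subseteq> A" "S \<inter> T = {}" "part_perm {A} ` T \<inter> S = {}" and j: "j \<in> T"
  shows "(\<Sum>P\<in>marked A S T. x ^ card P)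
     = (\<Sum>P\<in>marked (A - {j}) S (T - {j}). (x::'a::comm_semiring_1) ^ card P)"
proof (cases "card A \<le> 1")
  case True
  then have "genus_one A = {}" "genus_one (A - {j}) = {}"
    using A by (auto intro!: genus_one_small simp: card_Diff_singleton_if)
  then show ?thesis by (simp add: marked_def)
next
  case False
  then have A2: "2 \<le> card A" and jA: "j \<in> A" using ST j by auto
  define s where "s = part_perm {A} j"
  have s: "s \<noteq> j" "s \<in> A" using part_perm_whole_neq[OF A A2 jA] by (auto simp: s_def)
  have s_csucc: "csucc A j = s" using jA by (simp add: s_def part_perm_whole)
  have jS: "j \<notin> S" "s \<notin> S" using ST j by (auto simp: s_def)
  define del where "del P = insert (block P j - {j}) (P - {block P j})" for P
  define ins where "ins P = insert (insert j (block P s)) (P - {block P s})" for P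
  have del: "del P \<in> marked (A - {j}) S (T - {j}) \<longleftrightarrow> P \<in> marked A S T"
    "ins (del P) = P" "card (del P) = card P"
    if P: "partition_on A P" and fj: "part_perm P j = s" for P
  proof -
    let ?B = "block P j"
    note B = block_mem[OF P jA]
    have sB: "s \<in> ?B" using part_perm_mem_block[OF P B] fj by simp
    have Bj: "?B \<noteq> {j}" using sB s by auto
    note part = partition_on_remove[OF P B Bj, folded del_def]
    have f': "part_perm (del P) = transpose j s \<circ> part_perm P"
      unfolding del_def part_perm_remove[OF P A B Bj] fj ..
    have z': "part_perm {A - {j}} = transpose j s \<circ> part_perm {A}"
      using part_perm_whole_remove[OF A A2 jA] by (simp add: s_def)
    have tr: "transpose j s x = transpose j s y \<longleftrightarrow> x = y" for x y
      by (metis transpose_involutory)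
    have inj: "part_perm P x = part_perm P y \<longleftrightarrow> x = y" for x y
      using permutes_inj[OF part_perm_permutes[OF P A]] by (auto dest: injD)
    have fS: "part_perm (del P) i = i \<longleftrightarrow> part_perm P i = i" if "i \<in> S" for i
      using that jS fj inj unfolding f' comp_apply
      by (metis transpose_apply_first transpose_apply_other transpose_apply_second)
    have fT: "part_perm (del P) i = part_perm {A - {j}} i \<longleftrightarrow> part_perm P i = part_perm {A} i" for i
      unfolding f' z' by (simp add: tr)
    have "del P \<in> genus_one (A - {j}) \<longleftrightarrow> P \<in> genus_one A"
      unfolding del_def using fj by (intro genus_one_contract[OF A A2 P B(2,1) Bj]) (simp add: s_def)
    then show "del P \<in> marked (A - {j}) S (T - {j}) \<longleftrightarrow> P \<in> marked A S T"
      using fS fT fj j by (auto simp: marked_def s_def)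
    have "block (del P) s = ?B - {j}"
      using sB s by (intro block_eq[OF part]) (auto simp: del_def)
    moreover have notin: "?B - {j} \<notin> P"
    proof
      assume "?B - {j} \<in> P"
      then have "?B - {j} = ?B" using sB s block_eq[OF P _ , of "?B - {j}" s] block_eq[OF P B(1) sB] by auto
      then show False using B by auto
    qed
    ultimately show "ins (del P) = P"
      using B by (auto simp: ins_def del_def insert_absorb)
    show "card (del P) = card P"
      using notin B(1) finite_elements[OF A P] unfolding del_def
      by (subst card_insert_disjoint) (auto simp del: card_Diff_insert card_Diff_singleton intro: card_Suc_Diff1)
  qed
  have ins: "partition_on A (ins P)" "part_perm (ins P) j = s" "del (ins P) = P"
    if P: "partition_on (A - {j}) P" for P
  proof -
    let ?B = "block P s"
    have B: "?B \<in> P" "s \<in> ?B" using block_mem[OF P, of s] s by auto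
    have jP: "j \<notin> \<Union>P" using P by (auto simp: partition_on_def)
    have disj: "C \<inter> D = {}" if "C \<in> P" "D \<in> P" "C \<noteq> D" for C D
      using P that by (auto simp: partition_on_def dest: disjointD)
    show part: "partition_on A (ins P)"
    proof (rule partition_onI)
      show "\<Union>(ins P) = A"
      proof -
        have "\<Union>(ins P) = insert j (\<Union>P)" using B by (auto simp: ins_def)
        then show ?thesis using P jA by (auto simp: partition_on_def)
      qed
      show "disjnt C D" if "C \<in> ins P" "D \<in> ins P" "C \<noteq> D" for C D
        using that disj B jP by (auto simp: ins_def disjnt_def)
      show "{} \<notin> ins P" using P by (auto simp: ins_def partition_on_def)
    qed
    have "part_perm (ins P) j = csucc (insert j ?B) j"
      by (rule part_perm_eq[OF part]) (auto simp: ins_def)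
    \<comment> \<open>The point s comes next after \<open>j\<close> in all of \<open>A\<close>,
      hence also in the block.\<close>
    also have "\<dots> = csucc A j"
      using B P jA by (intro csucc_subset) (auto simp: s_csucc partition_on_def)
    finally show "part_perm (ins P) j = s" by (simp add: s_csucc)
    have bj: "block (ins P) j = insert j ?B" by (rule block_eq[OF part]) (auto simp: ins_def)
    have "insert j ?B \<notin> P" "j \<notin> ?B" using jP B by auto
    then show "del (ins P) = P" unfolding del_def bj using B by (auto simp: ins_def)
  qed
  show ?thesis
  proof (rule sum.reindex_bij_witness[of _ ins del])
    fix P assume P: "P \<in> marked A S T"
    have fj: "part_perm P j = s" using P j by (auto simp: marked_def s_def)
    note d = del[OF marked_genus_oneD[OF P] fj]
    show "ins (del P) = P" "del P \<in> marked (A - {j}) S (T - {j})" "x ^ card (del P) = x ^ card P"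
      using d P by auto
  next
    fix P assume P: "P \<in> marked (A - {j}) S (T - {j})"
    note i = ins[OF marked_genus_oneD[OF P]]
    show "del (ins P) = P" by (rule i)
    show "ins P \<in> marked A S T" using del(1)[OF i(1,2)] i(3) P by simp
  qed
qed

text \<open>The points of \<open>T\<close> go first, so that only singletons are left to delete when
  \<open>S\<close> is reached.\<close>

lemma sum_marked:
  assumes A: "finite A" and ST: "S \<subseteq> A" "T \<subseteq> A" "S \<inter> T = {}" "part_perm {A} ` T \<inter> S = {}"
  shows "(\<Sum>P\<in>marked A S T. fps_X ^ card P) = fps_X ^ card S * genus_one_poly (A - S - T)"
proof -
  have single: "(\<Sum>P\<in>marked A S {}. fps_X ^ card P) = fps_X ^ card S * genus_one_poly (A - S)"
    if "finite S" "finite A" "S \<subseteq> A" for A S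
    using that
  proof (induction S arbitrary: A rule: finite_induct)
    case empty
    then show ?case by (simp add: marked_def genus_one_poly_def)
  next
    case (insert j S)
    have "(\<Sum>P\<in>marked A (insert j S) {}. fps_X ^ card P)
        = fps_X * (\<Sum>P\<in>marked (A - {j}) S {}. fps_X ^ card P :: rat fps)"
      using sum_marked_remove_singleton[of A "insert j S" j "fps_X :: rat fps"] insert by simp
    also have "\<dots> = fps_X * (fps_X ^ card S * genus_one_poly (A - {j} - S))"
      using insert by (subst insert.IH) auto
    also have "A - {j} - S = A - insert j S" by auto
    finally show ?case using insert by (simp add: mult.assoc)
  qed
  have "finite T" using A ST finite_subset by blast
  then show ?thesis using A ST
  proof (induction T arbitrary: A rule: finite_induct)
    case empty
    then show ?case using single[of S A] finite_subset[of S A] by simp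
  next
    case (insert j T)
    have jA: "j \<in> A" and jS: "j \<notin> S" "part_perm {A} j \<notin> S" using insert by auto
    \<comment> \<open>Once \<open>j\<close> is deleted, the point in front of it is followed by
      \<open>part_perm {A} j\<close>, which the hypothesis keeps out of \<open>S\<close>.\<close>
    have disj: "part_perm {A - {j}} ` T \<inter> S = {}"
    proof (cases "card A \<le> 1")
      case True
      then have "A = {j}" using jA insert.prems(1) card_le_Suc0_iff_eq[of A] by auto
      then show ?thesis using insert by auto
    next
      case False
      then have A2: "2 \<le> card A" by simp
      have "part_perm {A - {j}} i \<notin> S" if "i \<in> T" for i
      proof -
        have "part_perm {A} i \<notin> S" using insert.prems that by auto
        then show ?thesis
          using jS unfolding part_perm_whole_remove[OF insert.prems(1) A2 jA] by (simp add: transpose_def)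
      qed
      then show ?thesis by auto
    qed
    have "(\<Sum>P\<in>marked A S (insert j T). fps_X ^ card P)
        = (\<Sum>P\<in>marked (A - {j}) S T. fps_X ^ card P :: rat fps)"
      using sum_marked_contract[of A S "insert j T" j "fps_X :: rat fps"] insert by simp
    also have "\<dots> = fps_X ^ card S * genus_one_poly (A - {j} - S - T)"
      using insert disj jS by (intro insert.IH) auto
    also have "A - {j} - S - T = A - S - insert j T" by auto
    finally show ?case .
  qed
qed

section \<open>Relabelling: only the number of points matters\<close>

lemma genus_one_image:
  assumes A: "finite A" and h: "strict_mono_on A h" and P: "P \<in> genus_one A"
  shows "(`) h ` P \<in> genus_one (h ` A)" "card ((`) h ` P) = card P"
proof -
  have inj: "inj_on h A" using strict_mono_on_imp_inj_on[OF h] .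
  have part: "partition_on A P" using P by (simp add: genus_one_def)
  have part': "partition_on (h ` A) ((`) h ` P)"
  proof -
    have "(`) h ` P - {{}} = (`) h ` P" using part by (auto simp: partition_on_def)
    then show ?thesis using partition_on_inj_image[OF part inj] by simp
  qed
  have f: "part_perm ((`) h ` P) (h i) = h (part_perm P i)" if "i \<in> A" for i
  proof -
    note B = block_mem[OF part that]
    have "part_perm ((`) h ` P) (h i) = csucc (h ` block P i) (h i)"
      using B by (intro part_perm_eq[OF part']) auto
    also have "\<dots> = h (csucc (block P i) i)"
      using B part by (intro csucc_image[OF h]) (auto simp: partition_on_def)
    finally show ?thesis using part_perm_eq[OF part B] by simp
  qed
  have z: "part_perm {h ` A} (h i) = h (part_perm {A} i)" if "i \<in> A" for i
    using that csucc_image[OF h, of A i] by (simp add: part_perm_whole)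
  note permf = part_perm_permutes[OF part A] and permz = part_perm_whole_permutes[OF A]
    and permf' = part_perm_permutes[OF part' finite_imageI[OF A]]
  have g: "(inv (part_perm ((`) h ` P)) \<circ> part_perm {h ` A}) (h i)
      = h ((inv (part_perm P) \<circ> part_perm {A}) i)" if "i \<in> A" for i
  proof -
    have "part_perm {A} i \<in> A" using that permutes_in_image[OF permz] by simp
    then have "inv (part_perm P) (part_perm {A} i) \<in> A"
      using permutes_in_image[OF permutes_inv[OF permf]] by simp
    then have "part_perm ((`) h ` P) (h (inv (part_perm P) (part_perm {A} i))) = h (part_perm {A} i)"
      using f permutes_inverses(1)[OF permf] by simp
    then show ?thesis using z[OF that] permutes_inv_eq[OF permf'] by simp
  qed
  have "cycle_count (h ` A) (inv (part_perm ((`) h ` P)) \<circ> part_perm {h ` A})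
      = cycle_count A (inv (part_perm P) \<circ> part_perm {A})"
    by (rule cycle_count_image[OF permutes_compose[OF permz permutes_inv[OF permf]] g inj])
  then show "(`) h ` P \<in> genus_one (h ` A)"
    using P part' card_image[OF inj] cycle_count_image[OF permf f inj]
    by (auto simp: genus_one_def)
  show "card ((`) h ` P) = card P"
    using part inj by (intro card_image inj_on_subset[OF inj_on_image_Pow[OF inj]]) (auto simp: partition_on_def)
qed

lemma genus_one_poly_image:
  assumes A: "finite A" and h: "strict_mono_on A h"
  shows "genus_one_poly (h ` A) = genus_one_poly A"
proof -
  define k where "k = inv_into A h"
  have inj: "inj_on h A" using strict_mono_on_imp_inj_on[OF h] .
  have kh: "k (h i) = i" if "i \<in> A" for i using that inj by (simp add: k_def)
  have k: "strict_mono_on (h ` A) k"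
    by (rule strict_mono_onI) (auto simp: kh strict_mono_on_less[OF h])
  have khA: "k ` h ` A = A" using kh by (auto simp: image_image)
  have PA: "X \<in> P \<Longrightarrow> P \<in> genus_one A \<Longrightarrow> X \<subseteq> A" for X P A
    by (auto simp: genus_one_def partition_on_def)
  show ?thesis
    unfolding genus_one_poly_def
  proof (rule sum.reindex_bij_witness[of _ "\<lambda>P. (`) h ` P" "\<lambda>P. (`) k ` P"])
    fix P assume P: "P \<in> genus_one (h ` A)"
    have "h ` k ` X = X" if "X \<in> P" for X
    proof -
      have "h (k x) = x" if "x \<in> h ` A" for x using that kh by auto
      then show ?thesis using PA[OF that P] by (force simp: image_image)
    qed
    then show "(`) h ` (`) k ` P = P" by (simp add: image_image)
    show "(`) k ` P \<in> genus_one A" "fps_X ^ card ((`) k ` P) = (fps_X ^ card P :: rat fps)"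
      using genus_one_image[OF finite_imageI[OF A] k P] khA by simp_all
  next
    fix P assume P: "P \<in> genus_one A"
    have "k ` h ` X = X" if "X \<in> P" for X
      using PA[OF that P] kh by (force simp: image_image)
    then show "(`) k ` (`) h ` P = P" by (simp add: image_image)
    show "(`) h ` P \<in> genus_one (h ` A)"
      using genus_one_image[OF A h P] by simp
  qed
qed

lemma genus_one_poly_card:
  assumes "finite A"
  shows "genus_one_poly A = genus_one_poly {..<card A}"
proof -
  let ?h = "\<lambda>i. sorted_list_of_set A ! i"
  have "strict_mono_on {..<card A} ?h"
    by (rule strict_mono_onI) (auto intro!: sorted_wrt_nth_less[OF strict_sorted_list_of_set])
  moreover have "?h ` {..<card A} = A"
    using assms set_conv_nth[of "sorted_list_of_set A"] by (auto simp: image_def)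
  ultimately show ?thesis using genus_one_poly_image[of "{..<card A}" ?h] by simp
qed

section \<open>Inclusion-exclusion over marked points\<close>

definition irreducible_partitions :: "nat \<Rightarrow> nat set set set" where
  "irreducible_partitions n =
     {P \<in> genus_one {..<n}. \<forall>i<n. part_perm P i \<noteq> i \<and> part_perm P i \<noteq> part_perm {{..<n}} i}"

lemma sum_Pow_alternating:
  assumes "finite A"
  shows "(\<Sum>S\<in>Pow A. (- 1) ^ card S) = (if A = {} then 1 else (0::'a::comm_ring_1))"
  using prod_diff_conv_sum[OF assms, of "\<lambda>_. 1 :: 'a" "\<lambda>_. 1"] assms by (auto simp: power_0_left)

lemma part_perm_lessThan: "i < n \<Longrightarrow> part_perm {{..<n}} i = Suc i mod n"
  using csucc_interval[of i 0 n]
  by (cases "Suc i = n") (auto simp: part_perm_whole lessThan_atLeast0)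

lemma sum_irreducible_partitions:
  "(\<Sum>P\<in>irreducible_partitions n. fps_X ^ card P)
     = sum (word_weight fps_X (\<lambda>m. genus_one_poly {..<m}) n) (cyclic_words n)"
proof -
  let ?A = "{..<n}" and ?z = "part_perm {{..<n}}"
  define F where "F P = {i\<in>?A. part_perm P i = i}" for P
  define G where "G P = {i\<in>?A. part_perm P i = ?z i}" for P
  have alt: "(\<Sum>S\<in>Pow ?A. if S \<subseteq> F then (- 1) ^ card S else 0) = (if F = {} then 1 else (0::rat fps))"
    if "F \<subseteq> ?A" for F
  proof -
    have "(\<Sum>S\<in>Pow ?A. if S \<subseteq> F then (- 1) ^ card S else 0) = (\<Sum>S\<in>Pow F. (- 1) ^ card S :: rat fps)"
      using that by (intro sum.mono_neutral_cong_right) auto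
    then show ?thesis using sum_Pow_alternating[of F, where ?'a = "rat fps"] that finite_subset by fastforce
  qed
  have prod3: "(\<Sum>S\<in>I. a S) * (\<Sum>T\<in>J. b T) * c = (\<Sum>S\<in>I. \<Sum>T\<in>J. a S * b T * c)"
    for I J :: "nat set set" and a b and c :: "rat fps"
    by (subst sum_product) (simp add: sum_distrib_right)
  have "(\<Sum>P\<in>irreducible_partitions n. fps_X ^ card P)
      = (\<Sum>P\<in>genus_one ?A. (if F P = {} then 1 else 0) * (if G P = {} then 1 else 0) * fps_X ^ card P :: rat fps)"
    unfolding irreducible_partitions_def
    by (rule sum.mono_neutral_cong_left) (auto simp: F_def G_def)
  \<comment> \<open>The indicator that a set of fixed points is empty becomes an alternating sum
    over its subsets, extended by zero to \<open>Pow ?A\<close> so that the sums can be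
    exchanged.\<close>
  also have "\<dots> = (\<Sum>P\<in>genus_one ?A. (\<Sum>S\<in>Pow ?A. if S \<subseteq> F P then (- 1) ^ card S else 0)
      * (\<Sum>T\<in>Pow ?A. if T \<subseteq> G P then (- 1) ^ card T else 0) * fps_X ^ card P)"
    by (intro sum.cong refl, subst (1 2) alt) (auto simp: F_def G_def)
  also have "\<dots> = (\<Sum>P\<in>genus_one ?A. \<Sum>(S, T)\<in>Pow ?A \<times> Pow ?A.
      if S \<subseteq> F P \<and> T \<subseteq> G P then (- 1) ^ card S * (- 1) ^ card T * fps_X ^ card P else 0)"
  proof (rule sum.cong[OF refl])
    fix P
    have "(\<Sum>S\<in>Pow ?A. if S \<subseteq> F P then (- 1) ^ card S else 0)
        * (\<Sum>T\<in>Pow ?A. if T \<subseteq> G P then (- 1) ^ card T else 0) * fps_X ^ card P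
      = (\<Sum>S\<in>Pow ?A. \<Sum>T\<in>Pow ?A.
          (if S \<subseteq> F P then (- 1) ^ card S else 0) * (if T \<subseteq> G P then (- 1) ^ card T else 0) * fps_X ^ card P :: rat fps)"
      by (rule prod3)
    also have "\<dots> = (\<Sum>S\<in>Pow ?A. \<Sum>T\<in>Pow ?A.
          if S \<subseteq> F P \<and> T \<subseteq> G P then (- 1) ^ card S * (- 1) ^ card T * fps_X ^ card P else 0)"
      by (intro sum.cong refl) simp
    finally show "(\<Sum>S\<in>Pow ?A. if S \<subseteq> F P then (- 1) ^ card S else 0)
        * (\<Sum>T\<in>Pow ?A. if T \<subseteq> G P then (- 1) ^ card T else 0) * fps_X ^ card P
      = (\<Sum>(S, T)\<in>Pow ?A \<times> Pow ?A.
          if S \<subseteq> F P \<and> T \<subseteq> G P then (- 1) ^ card S * (- 1) ^ card T * fps_X ^ card P else 0 :: rat fps)"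
      by (simp only: sum.cartesian_product)
  qed
  also have "\<dots> = (\<Sum>(S, T)\<in>Pow ?A \<times> Pow ?A. \<Sum>P\<in>genus_one ?A.
      if S \<subseteq> F P \<and> T \<subseteq> G P then (- 1) ^ card S * (- 1) ^ card T * fps_X ^ card P else 0)"
    by (subst sum.swap) (simp add: case_prod_unfold)
  also have "\<dots> = (\<Sum>(S, T)\<in>Pow ?A \<times> Pow ?A. (- 1) ^ card S * (- 1) ^ card T * (\<Sum>P\<in>marked ?A S T. fps_X ^ card P))"
  proof (intro sum.cong refl, clarify)
    fix S T assume "S \<subseteq> ?A" "T \<subseteq> ?A"
    then have "marked ?A S T = {P \<in> genus_one ?A. S \<subseteq> F P \<and> T \<subseteq> G P}"
      by (auto simp: marked_def F_def G_def)
    then show "(\<Sum>P\<in>genus_one ?A. if S \<subseteq> F P \<and> T \<subseteq> G P then (- 1) ^ card S * (- 1) ^ card T * fps_X ^ card P else 0)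
      = (- 1) ^ card S * (- 1) ^ card T * (\<Sum>P\<in>marked ?A S T. fps_X ^ card P :: rat fps)"
      by (simp add: sum_distrib_left sum.If_cases Int_def)
  qed
  \<comment> \<open>A pair outside \<open>cyclic_words\<close> marks no partition: a common point of
    S and T would equal its own successor on the circle, and a point of T followed by a point of S
    would have the same image as that point.\<close>
  also have "\<dots> = (\<Sum>(S, T)\<in>cyclic_words n. (- 1) ^ card S * (- 1) ^ card T * (\<Sum>P\<in>marked ?A S T. fps_X ^ card P))"
  proof (rule sum.mono_neutral_right)
    show "cyclic_words n \<subseteq> Pow ?A \<times> Pow ?A" by (auto simp: cyclic_words_def)
    show "\<forall>w\<in>Pow ?A \<times> Pow ?A - cyclic_words n.
      (case w of (S, T) \<Rightarrow> (- 1) ^ card S * (- 1) ^ card T * (\<Sum>P\<in>marked ?A S T. fps_X ^ card P :: rat fps)) = 0"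
    proof (clarify)
      fix S T assume ST: "S \<subseteq> ?A" "T \<subseteq> ?A" "(S, T) \<notin> cyclic_words n"
      have "P \<notin> marked ?A S T" for P
      proof
        assume P: "P \<in> marked ?A S T"
        then have "genus_one ?A \<noteq> {}" by (auto simp: marked_def)
        then have n: "2 \<le> card ?A" using genus_one_small[of ?A] by fastforce
        have inj: "part_perm P x = part_perm P y \<longleftrightarrow> x = y" for x y
          using permutes_inj[OF part_perm_permutes[OF marked_genus_oneD[OF P]]] by (auto dest: injD)
        have fS: "part_perm P i = i" if "i \<in> S" for i using that P by (simp add: marked_def)
        have fT: "part_perm P i = Suc i mod n" if "i \<in> T" for i
          using that P ST part_perm_lessThan[of i n] by (auto simp: marked_def)
        have z: "Suc i mod n \<noteq> i" if "i \<in> ?A" for i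
          using part_perm_whole_neq(1)[OF _ n that] part_perm_lessThan[of i n] that by simp
        have "(S, T) \<in> cyclic_words n"
          unfolding cyclic_words_def
        proof (clarify, intro conjI ST)
          show "S \<inter> T = {}" using fS fT z ST by fastforce
          show "(\<lambda>i. Suc i mod n) ` T \<inter> S = {}"
          proof -
            have False if "i \<in> T" "Suc i mod n \<in> S" for i
              using fS[OF that(2)] fT[OF that(1)] inj[of "Suc i mod n" i] z[of i] that ST by auto
            then show ?thesis by auto
          qed
        qed
        then show False using ST by simp
      qed
      then have "marked ?A S T = {}" by blast
      then show "(- 1) ^ card S * (- 1) ^ card T * (\<Sum>P\<in>marked ?A S T. fps_X ^ card P :: rat fps) = 0"
        by simp
    qed
  qed simp
  also have "\<dots> = sum (word_weight fps_X (\<lambda>m. genus_one_poly {..<m}) n) (cyclic_words n)"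
  proof (intro sum.cong refl)
    fix w assume w: "w \<in> cyclic_words n"
    obtain S T where ST: "w = (S, T)" by fastforce
    have sub: "S \<subseteq> ?A" "T \<subseteq> ?A" "S \<inter> T = {}" and im: "(\<lambda>i. Suc i mod n) ` T \<inter> S = {}"
      using w by (auto simp: ST cyclic_words_def)
    have "?z ` T = (\<lambda>i. Suc i mod n) ` T"
      using sub part_perm_lessThan[of _ n] by (intro image_cong) auto
    then have "?z ` T \<inter> S = {}" using im by simp
    then have "(\<Sum>P\<in>marked ?A S T. fps_X ^ card P) = fps_X ^ card S * genus_one_poly (?A - S - T)"
      by (intro sum_marked sub) auto
    moreover have "genus_one_poly (?A - S - T) = genus_one_poly {..<n - card S - card T}"
    proof -
      have fin: "finite S" "finite T" using sub finite_subset by blast+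
      have "card (?A - S - T) = card (?A - S) - card T"
        using sub fin by (intro card_Diff_subset) auto
      also have "card (?A - S) = n - card S"
        using sub fin by (subst card_Diff_subset) auto
      finally show ?thesis using genus_one_poly_card[of "?A - S - T"] by simp
    qed
    ultimately show "(case w of (S, T) \<Rightarrow> (- 1) ^ card S * (- 1) ^ card T * (\<Sum>P\<in>marked ?A S T. fps_X ^ card P))
      = word_weight fps_X (\<lambda>m. genus_one_poly {..<m}) n w"
      by (simp add: ST word_weight_def power_minus[of "fps_X :: rat fps"] mult_ac)
  qed
  finally show ?thesis .
qed

section \<open>Agreement with the definitions of the theorem\<close>

lemma perm_of_partition_eq:
  assumes P: "partition_on A P" and A: "finite A"
  shows "perm_of_partition P = part_perm P"
proof
  fix i
  show "perm_of_partition P i = part_perm P i"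
  proof (cases "i \<in> \<Union>P")
    case True
    define B where "B = block P i"
    define cs where "cs = sorted_list_of_set B"
    have i: "i \<in> A" using True P by (auto simp: partition_on_def)
    have B: "B \<in> P" "i \<in> B" using block_mem[OF P i] by (auto simp: B_def)
    then have fin: "finite B" using P A by (auto simp: partition_on_def intro: finite_subset)
    have set: "set cs = B" and dist: "distinct cs" and sorted: "sorted_wrt (<) cs"
      using fin by (auto simp: cs_def)
    obtain m where m: "m < length cs" "cs ! m = i" using B set by (metis in_set_conv_nth)
    \<comment> \<open>The cycle moves each list entry to the next position modulo the length; in a
      sorted list this is the cyclic successor.\<close>
    have "map (cycle_of_list cs) cs = rotate1 cs"
      using cyclic_rotation[OF dist, of 1] by simp
    then have "cycle_of_list cs i = cs ! (Suc m mod length cs)"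
      using m by (metis nth_map nth_rotate1)
    also have "\<dots> = csucc B i"
    proof (cases "Suc m < length cs")
      case True
      have "csucc B i = cs ! Suc m"
      proof (rule csucc_eqI)
        show "cs ! Suc m \<in> B" using True set by (metis nth_mem)
        show "i < cs ! Suc m" using sorted_wrt_nth_less[OF sorted, of m "Suc m"] True m by simp
        fix j assume "j \<in> B" "i < j"
        then obtain l where l: "l < length cs" "cs ! l = j" using set by (metis in_set_conv_nth)
        have "m < l"
        proof (rule ccontr)
          assume "\<not> m < l"
          then have "j \<le> i" using sorted_wrt_nth_less[OF sorted, of l m] l m by (cases "l = m") auto
          then show False using \<open>i < j\<close> by simp
        qed
        then show "cs ! Suc m \<le> j"
          using sorted_wrt_nth_less[OF sorted, of "Suc m" l] l by (cases "l = Suc m") auto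
      qed
      then show ?thesis using True by simp
    next
      case False
      then have Suc_m: "Suc m = length cs" using m by simp
      have "csucc B i = cs ! 0"
      proof (rule csucc_eqI_wrap)
        show "cs ! 0 \<in> B" using m set by (metis gr_implies_not0 neq0_conv nth_mem)
        fix j assume "j \<in> B"
        then obtain l where l: "l < length cs" "cs ! l = j" using set by (metis in_set_conv_nth)
        show "j \<le> i" using sorted_wrt_nth_less[OF sorted, of l m] l m Suc_m by (cases "l = m") auto
        show "cs ! 0 \<le> j" using sorted_wrt_nth_less[OF sorted, of 0 l] l by (cases "l = 0") auto
      qed
      then show ?thesis using Suc_m by simp
    qed
    finally show ?thesis
      using True by (simp add: perm_of_partition_def part_perm_def cs_def B_def block_def)
  qed (simp add: perm_of_partition_def part_perm_def)
qed

lemma zeta_eq: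
  assumes "1 \<le> n"
  shows "zeta n = part_perm {{1..n}}"
proof
  fix i
  have "{1..n} = {1..<Suc n}" by auto
  then show "zeta n i = part_perm {{1..n}} i"
    using csucc_interval[of i 1 "Suc n"] assms by (auto simp: zeta_def part_perm_whole)
qed

lemma p0_eq: "of_nat (p0 n k) = fps_nth (genus_one_poly {..<n}) k"
proof -
  have has_genus_iff: "partition_on {1..n} P \<and> has_genus n (perm_of_partition P) 1 \<longleftrightarrow> P \<in> genus_one {1..n}" for P
  \<comment> \<open>For n = 0 both sides are false: the genus equation would read -1 = 0.\<close>
  proof (cases "n = 0")
    case True
    then show ?thesis
      by (auto simp: genus_one_def has_genus_def num_cycles_def cycle_count_def)
  next
    case False
    then show ?thesis
      using zeta_eq[of n] perm_of_partition_eq[of "{1..n}" P]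
      by (auto simp: genus_one_def has_genus_def num_cycles_def cycle_count_def)
  qed
  have "{P. partition_on {1..n} P \<and> card P = k \<and> has_genus n (perm_of_partition P) 1}
      = {P \<in> genus_one {1..n}. card P = k}"
    using has_genus_iff by blast
  then have "of_nat (p0 n k) = (\<Sum>P\<in>{P \<in> genus_one {1..n}. card P = k}. 1 :: rat)"
    by (simp add: p0_def)
  also have "\<dots> = (\<Sum>P\<in>genus_one {1..n}. fps_nth (fps_X ^ card P) k)"
    by (rule sum.mono_neutral_cong_left) (auto simp: fps_X_power_nth)
  also have "\<dots> = fps_nth (genus_one_poly {1..n}) k"
    by (simp add: genus_one_poly_def fps_sum_nth)
  also have "genus_one_poly {1..n} = genus_one_poly {..<n}"
    using genus_one_poly_card[of "{1..n}"] by simp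
  finally show ?thesis .
qed

section \<open>Chord diagrams unrolled along the integers\<close>

text \<open>The point \<open>i\<close> lies in the gap between consecutive elements \<open>p\<close>
  and \<open>q\<close> of \<open>X\<close>; an element of \<open>X\<close> belongs to the gap that
  it ends.\<close>

definition run :: "int set \<Rightarrow> int \<Rightarrow> int \<Rightarrow> int \<Rightarrow> bool" where
  "run X i p q \<longleftrightarrow> p \<in> X \<and> q \<in> X \<and> p < i \<and> i \<le> q \<and> (\<forall>t. p < t \<and> t < q \<longrightarrow> t \<notin> X)"

lemma run_unique:
  assumes "run X i p q" "run X i p' q'"
  shows "p = p'" "q = q'"
  using assms unfolding run_def by (metis linorder_neqE_linordered_idom order_less_le_trans order_le_less_trans)+

definition next_in :: "int set \<Rightarrow> int \<Rightarrow> int" where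
  "next_in X t = (THE q. q \<in> X \<and> t < q \<and> (\<forall>s. t < s \<and> s < q \<longrightarrow> s \<notin> X))"

lemma next_in_eqI:
  assumes "q \<in> X" "t < q" "\<And>s. t < s \<Longrightarrow> s < q \<Longrightarrow> s \<notin> X"
  shows "next_in X t = q"
  unfolding next_in_def using assms by (intro the_equality) (auto, metis linorder_neqE_linordered_idom)

lemma next_in_props:
  assumes "u \<in> X" "t < u"
  shows "next_in X t \<in> X" "t < next_in X t" "next_in X t \<le> u"
    "\<And>s. t < s \<Longrightarrow> s < next_in X t \<Longrightarrow> s \<notin> X"
proof -
  let ?q = "Min (X \<inter> {t<..u})"
  have fin: "finite (X \<inter> {t<..u})" and ne: "X \<inter> {t<..u} \<noteq> {}" using assms by auto
  have q: "?q \<in> X \<inter> {t<..u}" by (rule Min_in[OF fin ne])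
  have le: "s \<notin> X" if "t < s" "s < ?q" for s
  proof
    assume "s \<in> X"
    then have "?q \<le> s" using that q by (intro Min_le[OF fin]) auto
    then show False using that by simp
  qed
  have "next_in X t = ?q" using q le by (intro next_in_eqI) auto
  then show "next_in X t \<in> X" "t < next_in X t" "next_in X t \<le> u"
    "\<And>s. t < s \<Longrightarrow> s < next_in X t \<Longrightarrow> s \<notin> X"
    using q le by auto
qed

text \<open>Turns the number of breaks in an interval into a number of steps from break to
  break.\<close>

lemma funpow_next_in:
  assumes "u \<in> X" "t \<le> u"
  shows "(next_in X ^^ card (X \<inter> {t<..u})) t = u"
  using assms(2)
proof (induction "nat (u - t)" arbitrary: t rule: less_induct)
  case less
  show ?case
  proof (cases "t = u")
    case False
    then have "t < u" using less by simp
    note n = next_in_props[OF assms(1) this]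
    have "X \<inter> {t<..u} = insert (next_in X t) (X \<inter> {next_in X t<..u})"
      using n by (auto simp: not_less) (metis linorder_neqE_linordered_idom)
    then have "card (X \<inter> {t<..u}) = Suc (card (X \<inter> {next_in X t<..u}))" by simp
    moreover have "(next_in X ^^ card (X \<inter> {next_in X t<..u})) (next_in X t) = u"
      using n by (intro less.hyps) auto
    ultimately show ?thesis by (simp add: funpow_swap1)
  qed simp
qed

locale periodic_set =
  fixes X :: "int set" and m :: int
  assumes period: "i + m \<in> X \<longleftrightarrow> i \<in> X" and m_pos: "0 < m" and nonempty: "X \<noteq> {}"
begin

lemma period_mult: "i + m * k \<in> X \<longleftrightarrow> i \<in> X"
proof (induction k rule: int_induct[where k = 0])
  case (step1 k)
  then show ?case using period[of "i + m * k"] by (simp add: algebra_simps)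
next
  case (step2 k)
  then show ?case using period[of "i + m * (k - 1)"] by (simp add: algebra_simps)
qed simp

lemma mod_mem_iff: "i mod m \<in> X \<longleftrightarrow> i \<in> X"
  using period_mult[of "i mod m" "i div m"] by simp

lemma ex_greater: "\<exists>u\<in>X. t < u \<and> u \<le> t + m"
proof -
  obtain x where x: "x \<in> X" using nonempty by auto
  \<comment> \<open>This is the representative of the class of \<open>x\<close> among the
    \<open>m\<close> integers after \<open>t\<close>.\<close>
  let ?u = "t + 1 + (x - t - 1) mod m"
  have "?u mod m = x mod m" by (simp add: mod_simps)
  then have "?u \<in> X" using mod_mem_iff x by metis
  moreover have "0 \<le> (x - t - 1) mod m" "(x - t - 1) mod m < m" using m_pos by auto
  ultimately show ?thesis by (intro bexI[of _ ?u]) auto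
qed

lemma next_in_mem: "next_in X t \<in> X" "t < next_in X t" "\<And>s. t < s \<Longrightarrow> s < next_in X t \<Longrightarrow> s \<notin> X"
  using ex_greater[of t] next_in_props[of _ X t] by auto

lemma next_in_period: "next_in X (t + m) = next_in X t + m"
  using next_in_mem(1,2)[of t] next_in_mem(3)[of t] period[of "next_in X t"] period
  by (intro next_in_eqI) (auto, metis add.commute add_less_cancel_right diff_add_cancel)

lemma funpow_next_in_mem: "t \<in> X \<Longrightarrow> (next_in X ^^ k) t \<in> X"
  by (induction k) (auto intro: next_in_mem)

lemma run_next_in: "t \<in> X \<Longrightarrow> t < i \<Longrightarrow> i \<le> next_in X t \<Longrightarrow> run X i t (next_in X t)"
  using next_in_mem[of t] by (auto simp: run_def)

lemma ex_run: "\<exists>p q. run X i p q"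
proof -
  obtain u where u: "u \<in> X" "i - 1 - m < u" "u \<le> i - 1" using ex_greater[of "i - 1 - m"] by auto
  \<comment> \<open>The run of \<open>i\<close> starts at the last element of \<open>X\<close>
    before \<open>i\<close>; \<open>u\<close> bounds the search from below.\<close>
  let ?S = "X \<inter> {u..i - 1}"
  have fin: "finite ?S" and ne: "?S \<noteq> {}" using u by auto
  have p: "Max ?S \<in> ?S" by (rule Max_in[OF fin ne])
  have "i \<le> next_in X (Max ?S)"
  proof (rule ccontr)
    assume "\<not> i \<le> next_in X (Max ?S)"
    then have "next_in X (Max ?S) \<in> ?S" using p next_in_mem(1,2)[of "Max ?S"] by auto
    then show False using Max_ge[OF fin] next_in_mem(2)[of "Max ?S"] by fastforce
  qed
  then show ?thesis using run_next_in[of "Max ?S" i] p by auto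
qed

lemma run_eq_next_in: "run X i p q \<Longrightarrow> q = next_in X p"
  by (rule next_in_eqI[symmetric]) (auto simp: run_def)

lemma run_period: "run X i p q \<Longrightarrow> run X (i + m) (p + m) (q + m)"
proof -
  assume r: "run X i p q"
  have "t \<notin> X" if "p + m < t" "t < q + m" for t
  proof -
    have "t - m \<notin> X" using r that unfolding run_def by (simp add: less_diff_eq diff_less_eq)
    then show ?thesis using period[of "t - m"] by simp
  qed
  then show ?thesis using r period by (auto simp: run_def)
qed

lemma card_period: "card (X \<inter> {t..<t + m}) = card (X \<inter> {0..<m})"
proof -
  have inj: "inj_on (\<lambda>x. x mod m) {t..<t + m}"
  proof (rule inj_onI)
    fix x y assume xy: "x \<in> {t..<t + m}" "y \<in> {t..<t + m}" "x mod m = y mod m"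
    then have "m dvd x - y" by (simp add: mod_eq_dvd_iff)
    moreover have "\<bar>x - y\<bar> < m" using xy by auto
    ultimately show "x = y" using zdvd_imp_le[of m "\<bar>x - y\<bar>"] by force
  qed
  have "(\<lambda>x. x mod m) ` (X \<inter> {t..<t + m}) = X \<inter> {0..<m}"
  proof (intro equalityI subsetI)
    fix x assume x: "x \<in> X \<inter> {0..<m}"
    let ?u = "t + (x - t) mod m"
    have "?u mod m = x" using x by (simp add: mod_simps)
    moreover from this have "?u \<in> X" using mod_mem_iff[of ?u] x by simp
    moreover have "?u \<in> {t..<t + m}" using m_pos by simp
    ultimately show "x \<in> (\<lambda>x. x mod m) ` (X \<inter> {t..<t + m})" by (metis Int_iff rev_image_eqI)
  qed (use m_pos mod_mem_iff in auto)
  moreover have "card ((\<lambda>x. x mod m) ` (X \<inter> {t..<t + m})) = card (X \<inter> {t..<t + m})"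
    by (rule card_image) (rule inj_on_subset[OF inj], simp)
  ultimately show ?thesis by simp
qed

lemma funpow_next_in_period:
  assumes "t \<in> X"
  shows "(next_in X ^^ card (X \<inter> {0..<m})) t = t + m"
proof -
  have "{t<..t + m} = {t + 1..<t + 1 + m}" by auto
  then show ?thesis
    using funpow_next_in[of "t + m" X t] card_period[of "t + 1"] assms period m_pos by simp
qed

end

text \<open>A chord diagram on the cycle of length \<open>n\<close>, unrolled along the integers: \<open>a i\<close> is the
  first point after \<open>i\<close> that lies over the partner of \<open>i\<close>.\<close>

locale chord_lift =
  fixes n :: int and a :: "int \<Rightarrow> int"
  assumes period: "a (i + n) = a i + n" and twice: "a (a i) = i + n"
    and gt: "i + 1 < a i" and lt: "a i < i + n"
begin

text \<open>A break separates \<open>i\<close> from \<open>i + 1\<close> when their chords are not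
  parallel. By \<open>breaks_iff\<close> the breaks lie over the points on the long cycles of
  beta.\<close>

definition breaks :: "int set" where
  "breaks = {i. a (i + 1) \<noteq> a i - 1}"

lemma n_pos: "0 < n"
  using gt[of 0] lt[of 0] by simp

lemma a_inj: "a i = a j \<longleftrightarrow> i = j"
  by (metis add_right_cancel twice)

lemma period_mult: "a (i + n * k) = a i + n * k"
proof (induction k rule: int_induct[where k = 0])
  case (step1 k)
  then show ?case using period[of "i + n * k"] by (simp add: algebra_simps)
next
  case (step2 k)
  then show ?case using period[of "i + n * (k - 1)"] by (simp add: algebra_simps)
qed simp

lemma a_mod: "a (i mod n) mod n = a i mod n"
proof -
  have "a i = a (i mod n) + n * (i div n)"
    using period_mult[of "i mod n" "i div n"] by simp
  then show ?thesis by simp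
qed

lemma breaks_period: "i + n \<in> breaks \<longleftrightarrow> i \<in> breaks"
  using period[of "i + 1"] period[of i] by (simp add: breaks_def add.assoc add.commute[of n])

text \<open>Whether the chords at \<open>i\<close> and \<open>i + 1\<close> are parallel can equally
  be read off at their other ends.\<close>

lemma breaks_partner: "a i - 1 \<in> breaks \<longleftrightarrow> i \<in> breaks"
proof -
  have "a (a i - 1) = i + 1 + n \<longleftrightarrow> a i - 1 = a (i + 1)"
    using a_inj[of "a i - 1" "a (i + 1)"] twice[of "i + 1"] by simp
  moreover have "a i - 1 \<in> breaks \<longleftrightarrow> a (a i - 1) \<noteq> i + 1 + n"
    unfolding breaks_def by (simp add: twice) linarith
  moreover have "i \<in> breaks \<longleftrightarrow> a i - 1 \<noteq> a (i + 1)"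
    unfolding breaks_def by auto
  ultimately show ?thesis by blast
qed

lemma breaks_start: "i \<in> breaks \<Longrightarrow> a (i + 1) \<in> breaks"
  using breaks_partner[of "a (i + 1)"] breaks_period[of i] by (simp add: twice)

text \<open>If \<open>i\<close> is no break, the chord at \<open>i + 1\<close> is nested directly
  inside that at \<open>i\<close>. No chord joins neighbours, by \<open>gt\<close>, so this descent
  stops at a break, and the two ends of its chord give x and y.\<close>

lemma breaks_in_arc:
  "\<exists>x y. x \<in> breaks \<and> y \<in> breaks \<and> i \<le> x \<and> x < y \<and> y < a i \<and> a x = y + 1"
proof (induction "nat (a i - i)" arbitrary: i rule: less_induct)
  case less
  show ?case
  proof (cases "i \<in> breaks")
    case True
    then show ?thesis
      using breaks_partner[of i] gt[of i] by (intro exI[of _ i] exI[of _ "a i - 1"]) auto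
  next
    case False
    then have a: "a (i + 1) = a i - 1" by (simp add: breaks_def)
    have "nat (a (i + 1) - (i + 1)) < nat (a i - i)" using a gt[of i] by simp
    from less.hyps[OF this] obtain x y where "x \<in> breaks \<and> y \<in> breaks \<and> i + 1 \<le> x \<and> x < y \<and> y < a (i + 1) \<and> a x = y + 1"
      by blast
    then show ?thesis using a by (intro exI[of _ x] exI[of _ y]) auto
  qed
qed

sublocale breaks: periodic_set breaks n
  using breaks_period n_pos breaks_in_arc by unfold_locales auto

lemma a_run:
  assumes "p \<le> q" "\<And>t. p \<le> t \<Longrightarrow> t < q \<Longrightarrow> t \<notin> breaks"
  shows "a q = a p - (q - p)"
  using assms
proof (induction q rule: int_ge_induct)
  case (step q)
  have "q \<notin> breaks" using step.hyps step.prems[of q] by simp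
  moreover have "a q = a p - (q - p)" using step by simp
  ultimately show ?case by (simp add: breaks_def)
qed simp

lemma card_breaks_split:
  "card (breaks \<inter> {i..<a i}) + card (breaks \<inter> {a i..<a (a i)}) = card (breaks \<inter> {0..<n})"
proof -
  have "breaks \<inter> {i..<i + n} = (breaks \<inter> {i..<a i}) \<union> (breaks \<inter> {a i..<a (a i)})"
    using gt[of i] lt[of i] by (auto simp: twice)
  then have "card (breaks \<inter> {i..<i + n}) = card (breaks \<inter> {i..<a i}) + card (breaks \<inter> {a i..<a (a i)})"
    by (simp only:) (rule card_Un_disjoint; auto)
  then show ?thesis using breaks.card_period by simp
qed

lemma card_breaks_ge2: "2 \<le> card (breaks \<inter> {i..<a i})"
proof -
  obtain x y where "x \<in> breaks" "y \<in> breaks" "i \<le> x" "x < y" "y < a i"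
    using breaks_in_arc[of i] by blast
  then have "card {x, y} \<le> card (breaks \<inter> {i..<a i})" by (intro card_mono) auto
  then show ?thesis using \<open>x < y\<close> by simp
qed

text \<open>The map taking j to \<open>a (j + 1)\<close> lifts beta. If the arc held only the breaks
  x < y of \<open>breaks_in_arc\<close>, the run from x + 1 to y would give
  \<open>a y = a (x + 1) - (y - (x + 1))\<close>, while \<open>cube\<close> at y makes
  \<open>a y\<close> congruent to \<open>a (x + 1) + 1\<close>. Then n divides y - x, which is
  positive and less than n. This forces six breaks to be split 3 and 3, not 2 and 4.\<close>

lemma card_breaks_ge3:
  assumes cube: "\<And>y. y \<in> breaks \<Longrightarrow> a (a (a (y + 1) + 1) + 1) mod n = y mod n"
  shows "3 \<le> card (breaks \<inter> {i..<a i})"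
proof (rule ccontr)
  assume "\<not> 3 \<le> card (breaks \<inter> {i..<a i})"
  then have 2: "card (breaks \<inter> {i..<a i}) = 2" using card_breaks_ge2[of i] by simp
  obtain x y where xy: "x \<in> breaks" "y \<in> breaks" "i \<le> x" "x < y" "y < a i" "a x = y + 1"
    using breaks_in_arc[of i] by blast
  then have eq: "{x, y} = breaks \<inter> {i..<a i}"
    using 2 by (intro card_subset_eq) auto
  have "t \<notin> breaks" if "x + 1 \<le> t" "t < y" for t
  proof
    assume "t \<in> breaks"
    then have "t \<in> {x, y}" unfolding eq using that xy by auto
    then show False using that by auto
  qed
  then have ay: "a y = a (x + 1) - (y - (x + 1))" using xy by (intro a_run) auto
  have "a (y + 1) = x + n" using xy(6) twice[of x] by simp
  then have "a (y + 1) + 1 = x + 1 + n" by simp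
  then have "a (a (y + 1) + 1) = a (x + 1) + n" by (simp only: period)
  then have "a (a (y + 1) + 1) + 1 = a (x + 1) + 1 + n" by simp
  then have "a (a (a (y + 1) + 1) + 1) = a (a (x + 1) + 1) + n" by (simp only: period)
  then have "a (a (x + 1) + 1) mod n = y mod n" using cube[OF xy(2)] by simp
  then obtain k where k: "a (a (x + 1) + 1) = y + n * k"
    by (metis mod_eqE)
  have "a (x + 1) + 1 + n = a y + n * k"
    using period_mult[of y k] k twice[of "a (x + 1) + 1"] by simp
  then have "y - x = n * (k - 1)" using ay by (simp add: algebra_simps)
  moreover have "0 < y - x" "y - x < n" using xy lt[of i] by auto
  ultimately show False using n_pos by (metis mult_less_cancel_left_pos mult_1_right mult_pos_neg
    zero_less_mult_pos linorder_not_less int_one_le_iff_zero_less)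
qed

text \<open>The run after a break is reversed onto the run starting \<open>h\<close> breaks later. Hence both have
  the same length, and the distance between a break and its \<open>h\<close>-th successor is constant.\<close>

lemma half_period:
  assumes half: "\<And>i. card (breaks \<inter> {i..<a i}) = h" and h: "card (breaks \<inter> {0..<n}) = 2 * h" "0 < h"
    and t: "t \<in> breaks"
  shows "n = 2 * ((next_in breaks ^^ h) t - t)"
proof -
  let ?s = "next_in breaks"
  define e where "e t = (?s ^^ h) t - t" for t
  \<comment> \<open>The arc from \<open>t + 1\<close> contains \<open>h\<close> breaks, and its end
    is one more.\<close>
  have start: "a (t + 1) = (?s ^^ Suc h) t" if t: "t \<in> breaks" for t
  proof -
    have u: "a (t + 1) \<in> breaks" using breaks_start[OF t] .
    have tu: "t + 1 < a (t + 1)" using gt[of "t + 1"] by simp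
    have "breaks \<inter> {t<..a (t + 1)} = insert (a (t + 1)) (breaks \<inter> {t + 1..<a (t + 1)})"
      using u tu by auto
    then have "card (breaks \<inter> {t<..a (t + 1)}) = Suc h" using half[of "t + 1"] by simp
    then show ?thesis using funpow_next_in[OF u, of t] tu by simp
  qed
  \<comment> \<open>The \<open>h\<close> breaks in the arc from \<open>t\<close> include
    \<open>t\<close> itself, and the last of them is \<open>a t - 1\<close>.\<close>
  have fin: "a t = (?s ^^ (h - 1)) t + 1" if t: "t \<in> breaks" for t
  proof -
    have u: "a t - 1 \<in> breaks" using breaks_partner t by simp
    have "breaks \<inter> {t..<a t} = insert t (breaks \<inter> {t<..a t - 1})"
      using t gt[of t] by auto
    then have "card (breaks \<inter> {t<..a t - 1}) = h - 1" using half[of t] by simp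
    then show ?thesis using funpow_next_in[OF u, of t] gt[of t] by simp
  qed
  \<comment> \<open>The run from \<open>t + 1\<close> to \<open>?s t\<close> has its two ends sent
    to the places given by \<open>start\<close> and \<open>fin\<close>; comparing lengths gives the
    claim.\<close>
  have e_next: "e (?s t) = e t" if t: "t \<in> breaks" for t
  proof -
    let ?t = "?s t"
    have "a ?t = a (t + 1) - (?t - (t + 1))"
      using breaks.next_in_mem[of t] by (intro a_run) auto
    moreover have "a ?t = (?s ^^ h) t + 1"
      using fin[OF breaks.next_in_mem(1)] h(2) by (cases h) (simp_all add: funpow_swap1)
    ultimately show ?thesis using start[OF t] by (simp add: e_def funpow_swap1)
  qed
  have e_funpow: "e ((?s ^^ k) t) = e t" for k
    by (induction k) (use e_next breaks.funpow_next_in_mem[OF t] in auto)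
  have "t + n = (?s ^^ (h + h)) t"
    using breaks.funpow_next_in_period[OF t] h(1) by (simp add: mult_2)
  also have "\<dots> = e ((?s ^^ h) t) + e t + t"
    by (simp add: e_def funpow_add)
  finally have "t + n = e t + e t + t" unfolding e_funpow .
  then show ?thesis by (simp add: e_def)
qed

text \<open>Hence \<open>a\<close> is determined by its breaks: the first point of the run from p to
  q is sent to q + c by counting breaks, and the rest of the run follows in reverse order.\<close>

lemma half_structure:
  assumes half: "\<And>i. card (breaks \<inter> {i..<a i}) = h" and h: "card (breaks \<inter> {0..<n}) = 2 * h" "0 < h"
    and c: "n = 2 * c"
  shows "i + c \<in> breaks \<longleftrightarrow> i \<in> breaks" "run breaks i p q \<Longrightarrow> a i = p + q + 1 + c - i"
proof -
  have nxt: "(next_in breaks ^^ h) t = t + c" if "t \<in> breaks" for t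
    using half_period[OF half h that] c by simp
  have shift: "t + c \<in> breaks" if "t \<in> breaks" for t
    using nxt[OF that] breaks.funpow_next_in_mem[OF that, of h] by simp
  show "i + c \<in> breaks \<longleftrightarrow> i \<in> breaks"
    using shift[of i] shift[of "i + c"] breaks_period[of i] c by (auto simp: add.assoc)
  assume r: "run breaks i p q"
  then have p: "p \<in> breaks" "q \<in> breaks" "p < i" "i \<le> q" "\<And>t. p < t \<Longrightarrow> t < q \<Longrightarrow> t \<notin> breaks"
    by (auto simp: run_def)
  have u: "a (p + 1) \<in> breaks" using breaks_start[OF p(1)] .
  have pu: "p + 1 < a (p + 1)" using gt[of "p + 1"] by simp
  have "breaks \<inter> {p<..a (p + 1)} = insert (a (p + 1)) (breaks \<inter> {p + 1..<a (p + 1)})"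
    using u pu by auto
  then have "card (breaks \<inter> {p<..a (p + 1)}) = Suc h" using half[of "p + 1"] by simp
  then have "a (p + 1) = (next_in breaks ^^ Suc h) p" using funpow_next_in[OF u, of p] pu by simp
  also have "\<dots> = q + c"
    using nxt[OF p(2)] breaks.run_eq_next_in[OF r] by (simp add: funpow_swap1)
  finally have "a (p + 1) = q + c" .
  moreover have "a i = a (p + 1) - (i - (p + 1))" using p by (intro a_run) auto
  ultimately show "a i = p + q + 1 + c - i" by simp
qed

end

text \<open>Conversely, reflecting every run and then moving it half way round gives a chord diagram.\<close>

definition reflect :: "int set \<Rightarrow> int \<Rightarrow> int \<Rightarrow> int" where
  "reflect X c i = (THE v. \<exists>p q. run X i p q \<and> v = p + q + 1 + c - i)"

lemma reflect_eq: "run X i p q \<Longrightarrow> reflect X c i = p + q + 1 + c - i"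
  unfolding reflect_def by (rule the_equality) (auto dest: run_unique)

context periodic_set
begin

lemma reflect_chord_lift:
  assumes two: "2 \<le> card (X \<inter> {0..<m})"
  shows "chord_lift (2 * m) (reflect X m)"
proof
  fix i
  obtain p q where r: "run X i p q" using ex_run by blast
  note a = reflect_eq[OF r, of m]
  have "run X (i + 2 * m) (p + 2 * m) (q + 2 * m)"
    using run_period[OF run_period[OF r]] by (simp only: add.assoc mult_2)
  from reflect_eq[OF this, of m]
  show "reflect X m (i + 2 * m) = reflect X m i + 2 * m" using a by simp
  have i: "p < i" "i \<le> q" using r by (auto simp: run_def)
  have "run X (reflect X m i) (p + m) (q + m)"
    using run_period[OF r] i unfolding a by (auto simp: run_def)
  from reflect_eq[OF this, of m]
  show "reflect X m (reflect X m i) = i + 2 * m" using a by simp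
  \<comment> \<open>Two breaks per period keep a run shorter than \<open>m\<close>. With a single
    one, q would be p + m and the last point of a run would be joined to its neighbour.\<close>
  have "q < p + m"
  proof -
    have "card (X \<inter> {p + 1..<p + 1 + m}) \<noteq> card {p + m}"
      using card_period[of "p + 1"] two by simp
    then have "X \<inter> {p + 1..<p + 1 + m} \<noteq> {p + m}" by metis
    moreover have "p + m \<in> X \<inter> {p + 1..<p + 1 + m}" using r period m_pos by (auto simp: run_def)
    ultimately obtain t where "t \<in> X" "p < t" "t < p + m" by fastforce
    then show ?thesis using r unfolding run_def by (metis linorder_not_less order_le_less_trans)
  qed
  then show "i + 1 < reflect X m i" "reflect X m i < i + 2 * m" using i a by auto
qed

text \<open>Inside a run the value drops by one at each step. After a break it jumps from the bottom
  of one reflected run to the top of the next.\<close>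

lemma breaks_reflect:
  assumes two: "2 \<le> card (X \<inter> {0..<m})"
  shows "chord_lift.breaks (reflect X m) = X"
proof -
  interpret chord_lift "2 * m" "reflect X m" by (rule reflect_chord_lift[OF two])
  have "i \<in> breaks \<longleftrightarrow> i \<in> X" for i
  proof -
    obtain p q where r: "run X i p q" using ex_run by blast
    note a = reflect_eq[OF r, of m]
    show ?thesis
    proof (cases "i \<in> X")
      case True
      then have q: "q = i" using r by (auto simp: run_def)
      have "run X (i + 1) i (next_in X i)" using True next_in_mem[of i] by (intro run_next_in) auto
      from reflect_eq[OF this, of m] have "reflect X m (i + 1) = next_in X i + m" by simp
      moreover have "p < next_in X i" using r next_in_mem(2)[of i] by (auto simp: run_def)
      ultimately show ?thesis using a q True by (simp add: breaks_def)
    next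
      case False
      then have "i \<noteq> q" using r by (auto simp: run_def)
      then have "run X (i + 1) p q" using r by (auto simp: run_def)
      from reflect_eq[OF this, of m] show ?thesis using a False by (simp add: breaks_def)
    qed
  qed
  then show ?thesis by blast
qed

lemma reflect_start:
  assumes "t \<in> X"
  shows "reflect X m (t + 1) = next_in X t + m"
proof -
  have "run X (t + 1) t (next_in X t)" using assms next_in_mem[of t] by (intro run_next_in) auto
  from reflect_eq[OF this, of m] show ?thesis by simp
qed

text \<open>Each step of beta takes a break to the next one, moved on by \<open>m\<close>. Three
  next steps add up to \<open>m\<close>, so the total is 4m, two full turns of length 2m.\<close>

lemma reflect_cube:
  assumes three: "card (X \<inter> {0..<m}) = 3" and t: "t \<in> X"
  shows "reflect X m (reflect X m (reflect X m (t + 1) + 1) + 1) = t + 2 * (2 * m)"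
proof -
  let ?s = "next_in X"
  have "?s (?s (?s t)) = t + m"
    using funpow_next_in_period[OF t] three by (simp add: numeral_3_eq_3)
  moreover have "reflect X m (reflect X m (t + 1) + 1) = ?s (?s t) + 2 * m"
    using reflect_start[OF t] reflect_start[of "?s t + m"] next_in_mem(1)[of t] period next_in_period by simp
  moreover have "reflect X m (?s (?s t) + 2 * m + 1) = ?s (?s (?s t)) + 3 * m"
  proof -
    have "?s (?s t) + 2 * m \<in> X" using next_in_mem(1)[of "?s t"] period_mult[of _ 2] by (simp add: mult.commute)
    moreover have "?s (?s (?s t) + 2 * m) = ?s (?s (?s t)) + 2 * m"
      using next_in_period[of "?s (?s t)"] next_in_period[of "?s (?s t) + m"] by (simp only: add.assoc mult_2)
    ultimately show ?thesis using reflect_start[of "?s (?s t) + 2 * m"] by simp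
  qed
  ultimately show ?thesis by simp
qed

end

section \<open>Irreducible genus one partitions\<close>

lemma csucc_pair:
  assumes "i \<in> B" "csucc B i = j" "csucc B j = i" "i \<noteq> j"
  shows "B = {i, j}"
proof -
  have "B \<subseteq> {i, j}" if "i < j" "i \<in> B" "csucc B i = j" "csucc B j = i" for i j
  proof
    fix k assume k: "k \<in> B"
    have ne: "B \<noteq> {}" using that by auto
    have i: "i < k \<Longrightarrow> j \<le> k"
      using ne by (cases rule: csucc_cases[of _ i]) (use that k in auto)
    have "k \<le> j \<and> i \<le> k"
      using ne by (cases rule: csucc_cases[of _ j]) (use that k in auto)
    then show "k \<in> {i, j}" using i by force
  qed
  from this[of i j] this[of j i] have "B \<subseteq> {i, j}"
    using assms csucc_mem[of B i] by (cases "i < j") auto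
  then show ?thesis using assms csucc_mem[of B i] by auto
qed

lemma csucc_doubleton: "i \<noteq> j \<Longrightarrow> csucc {i, j} i = j"
  using csucc_mem[of "{i, j}" i] csucc_eq_self_iff[of i "{i, j}"] by auto

lemma card_partition_pairs:
  assumes "finite A" "partition_on A P" "\<And>B. B \<in> P \<Longrightarrow> card B = 2"
  shows "card A = 2 * card P"
proof -
  have "finite B" if "B \<in> P" for B using assms(3)[OF that] by (simp add: card_ge_0_finite)
  then have "card (\<Union>P) = (\<Sum>B\<in>P. card B)"
    using assms(2) by (intro card_Union_disjoint) (auto simp: partition_on_def)
  then show ?thesis using assms by (simp add: partition_on_def)
qed

text \<open>For an involution \<open>f\<close> the inverse in beta can be replaced by
  \<open>f\<close>, so beta(j) = f(j + 1), and these are the points with beta(beta(j)) different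
  from j.\<close>

definition long_vertices :: "nat \<Rightarrow> (nat \<Rightarrow> nat) \<Rightarrow> nat set" where
  "long_vertices N f = {j \<in> {..<N}. f (Suc (f (Suc j mod N)) mod N) \<noteq> j}"

locale irreducible_partition =
  fixes N :: nat and P :: "nat set set"
  assumes part: "partition_on {..<N} P"
    and no_fix: "\<And>i. i < N \<Longrightarrow> part_perm P i \<noteq> i"
    and no_succ: "\<And>i. i < N \<Longrightarrow> part_perm P i \<noteq> Suc i mod N"
begin

abbreviation "f \<equiv> part_perm P"
abbreviation "g \<equiv> inv f \<circ> part_perm {{..<N}}"

lemma f_perm: "f permutes {..<N}"
  by (rule part_perm_permutes[OF part]) simp

lemma g_perm: "g permutes {..<N}"
  by (intro permutes_compose permutes_inv f_perm part_perm_whole_permutes) simp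

lemma f_g: "i < N \<Longrightarrow> f (g i) = Suc i mod N"
  using permutes_inverses(1)[OF f_perm] part_perm_lessThan[of i N] by simp

lemma f_less: "i < N \<Longrightarrow> f i < N"
  using permutes_in_image[OF f_perm, of i] by simp

lemma g_less: "i < N \<Longrightarrow> g i < N"
  using permutes_in_image[OF g_perm, of i] by simp

sublocale f: derangement "{..<N}" f
  using f_perm no_fix by unfold_locales auto

sublocale g: derangement "{..<N}" g
  using g_perm f_g no_succ by unfold_locales (auto, metis)

text \<open>Along a shortest chord under the arc from \<open>i\<close> to \<open>f i\<close>, the cycle of \<open>g\<close> through its two
  ends cannot have length two.\<close>

lemma long_in_arc:
  assumes "i < N" "i < f i"
  shows "\<exists>x y. x \<in> g.long \<and> y \<in> g.long \<and> i \<le> x \<and> x < y \<and> y < f i"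
  using assms
proof (induction "f i - i" arbitrary: i rule: less_induct)
  case less
  define y where "y = f i - 1"
  have fi: "f i < N" using f_less less by simp
  have "f i \<noteq> Suc i" using no_succ[OF less.prems(1)] less.prems(2) fi by auto
  then have y: "i < y" "y < f i" "Suc y = f i" "y < N" using less.prems fi by (auto simp: y_def)
  have gy: "g y = i" using f_g[OF y(4)] y fi f.f_inj by (metis mod_less)
  show ?case
  proof (cases "g i = y")
    case False
    then have "y \<in> g.long" "i \<in> g.long"
      using gy y less.prems g.f_inj by (auto simp: g.long_def simp del: comp_apply)
    then show ?thesis using y by blast
  next
    \<comment> \<open>The block of \<open>y\<close> now contains \<open>i + 1\<close>. The point
      following \<open>i + 1\<close> in it need not be \<open>y\<close>, but does not exceed
      \<open>y\<close>, so the arc from \<open>i + 1\<close> is shorter and lies inside the given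
      one.\<close>
    case True
    then have fy: "f y = Suc i" using f_g[OF less.prems(1)] y fi by (simp del: comp_apply)
    have "Suc i \<noteq> y" using fy no_fix[OF y(4)] by auto
    then have lt: "Suc i < y" using y by simp
    then have iN: "Suc i < N" using y by simp
    note B = block_mem[OF part, of y]
    have "Suc i \<in> block P y"
      using part_perm_mem_block[OF part B] fy y by simp
    then have "f (Suc i) = csucc (block P y) (Suc i)"
      using B y by (intro part_perm_eq[OF part]) auto
    moreover have "Suc i < csucc (block P y) (Suc i) \<and> csucc (block P y) (Suc i) \<le> y"
    proof -
      have mem: "y \<in> block P y" and ne: "block P y \<noteq> {}" using B y by auto
      show ?thesis using ne
        by (cases rule: csucc_cases[of _ "Suc i"]) (use mem lt in force)+
    qed
    ultimately have "Suc i < f (Suc i)" "f (Suc i) \<le> y" by auto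
    have "f (Suc i) - Suc i < f i - i"
      using \<open>Suc i < f (Suc i)\<close> \<open>f (Suc i) \<le> y\<close> y(3) by arith
    from less.hyps[OF this iN \<open>Suc i < f (Suc i)\<close>] obtain x z where
      "x \<in> g.long" "z \<in> g.long" "Suc i \<le> x" "x < z" "z < f (Suc i)" by blast
    then show ?thesis using \<open>f (Suc i) \<le> y\<close> y by (intro exI[of _ x] exI[of _ z]) auto
  qed
qed

text \<open>A long cycle of alpha uses up excess, leaving beta with excess at most 1 and so with at
  most three long points. But the arcs from a to f a and from f a to f (f a), with a the least point
  of the block, are disjoint and each contains two.\<close>

lemma involution:
  assumes genus: "P \<in> genus_one {..<N}"
  shows "f.long = {}"
proof (rule ccontr)
  assume ne: "f.long \<noteq> {}"
  have sum: "N = cycle_count {..<N} f + cycle_count {..<N} g + 1"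
    using genus by (simp add: genus_one_def)
  have "N \<noteq> 2 * cycle_count {..<N} f" using f.long_empty_iff ne by simp
  then have "N - 2 * cycle_count {..<N} g \<le> 1" using f.cycle_count_le sum by simp
  then have le3: "card g.long \<le> 3" using g.card_long_le by simp
  obtain i where i: "i < N" "f (f i) \<noteq> i" using ne by (auto simp: f.long_def)
  define B where "B = block P i"
  have B: "B \<in> P" "i \<in> B" using block_mem[OF part, of i] i by (auto simp: B_def)
  have f_B: "f k = csucc B k" "f k \<in> B" if "k \<in> B" for k
    using part_perm_eq[OF part B(1) that] part_perm_mem_block[OF part B(1) that] by auto
  have BN: "k < N" if "k \<in> B" for k using B(1) part that by (auto simp: partition_on_def)
  define a where "a = (LEAST k. k \<in> B)"
  have a: "a \<in> B" "\<And>k. k \<in> B \<Longrightarrow> a \<le> k" unfolding a_def using B by (auto intro: LeastI Least_le)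
  have neB: "B \<noteq> {}" using B by auto
  have up: "k < f k" "\<And>l. l \<in> B \<Longrightarrow> k < l \<Longrightarrow> f k \<le> l" if "k \<in> B" "l \<in> B" "k < l" for k l
  proof -
    have "k < csucc B k \<and> (\<forall>l\<in>B. k < l \<longrightarrow> csucc B k \<le> l)"
      using neB by (cases rule: csucc_cases[of _ k]) (use that in force)+
    then show "k < f k" "\<And>l. l \<in> B \<Longrightarrow> k < l \<Longrightarrow> f k \<le> l" using f_B that by auto
  qed
  have three: "\<exists>k\<in>B. k \<noteq> u \<and> k \<noteq> v" for u v
  proof (rule ccontr)
    assume "\<not> ?thesis"
    then have "{i, f i, f (f i)} \<subseteq> {u, v}" using B f_B by blast
    then have "card {i, f i, f (f i)} \<le> card {u, v}" by (intro card_mono) auto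
    also have "\<dots> \<le> 2" by (simp add: card_insert_if)
    finally have "card {i, f i, f (f i)} \<le> 2" .
    moreover have "i \<noteq> f i" using no_fix[OF i(1)] by simp
    ultimately show False using i f.f_inj by (simp add: card_insert_if)
  qed
  \<comment> \<open>Here \<open>k\<close>, and \<open>l\<close> below, witness that neither
    \<open>a\<close> nor \<open>f a\<close> is the last point of the block, so \<open>f\<close>
    moves both upwards.\<close>
  obtain k where k: "k \<in> B" "a < k" using three[of a a] a(2) by (metis le_neq_implies_less)
  note a_up = up[OF a(1) k]
  obtain l where l: "l \<in> B" "f a < l"
    using three[of a "f a"] a(2) a_up(2) by (metis le_neq_implies_less)
  note b_up = up[OF f_B(2)[OF a(1)] l]
  obtain x y where xy: "x \<in> g.long" "y \<in> g.long" "x < y" "y < f a"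
    using long_in_arc[of a] a_up(1) BN a by auto
  obtain z w where zw: "z \<in> g.long" "w \<in> g.long" "f a \<le> z" "z < w"
    using long_in_arc[of "f a"] b_up(1) BN f_B a by blast
  have "card {x, y, z, w} \<le> card g.long"
    using xy zw by (intro card_mono) (auto simp: g.long_def)
  moreover have "card {x, y, z, w} = 4" using xy zw by auto
  ultimately show False using le3 by simp
qed

lemma long_vertices_eq:
  assumes "f.long = {}"
  shows "g.long = long_vertices N f"
    and "\<And>j. j < N \<Longrightarrow> g j = f (Suc j mod N)"
proof -
  have ff: "f (f i) = i" if "i < N" for i using assms that by (auto simp: f.long_def)
  show g: "g j = f (Suc j mod N)" if "j < N" for j
    using ff[of "g j"] f_g[OF that] g_less[OF that] by simp
  then have "g (g j) = f (Suc (f (Suc j mod N)) mod N)" if "j < N" for j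
    using that g_less[OF that] g[of "g j"] by (simp del: comp_apply)
  then show "g.long = long_vertices N f"
    by (auto simp: g.long_def long_vertices_def simp del: comp_apply)
qed

lemma genus_one_iff:
  assumes "f.long = {}"
  shows "P \<in> genus_one {..<N} \<longleftrightarrow> card (long_vertices N f) = 4 \<or>
    card (long_vertices N f) = 6 \<and>
      (\<forall>j\<in>long_vertices N f. f (Suc (f (Suc (f (Suc j mod N)) mod N)) mod N) = j)"
proof -
  have "g (g (g j)) = f (Suc (f (Suc (f (Suc j mod N)) mod N)) mod N)" if "j < N" for j
    using that long_vertices_eq(2)[OF assms] g_less by (simp del: comp_apply)
  then have cube: "(\<forall>j\<in>g.long. g (g (g j)) = j)
      \<longleftrightarrow> (\<forall>j\<in>long_vertices N f. f (Suc (f (Suc (f (Suc j mod N)) mod N)) mod N) = j)"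
    unfolding long_vertices_eq(1)[OF assms] by (auto simp: long_vertices_def simp del: comp_apply)
  have "N = 2 * cycle_count {..<N} f" using f.long_empty_iff assms by simp
  then have "P \<in> genus_one {..<N} \<longleftrightarrow> card {..<N} = 2 * cycle_count {..<N} g + 2"
    using part by (auto simp: genus_one_def)
  then show ?thesis
    using g.excess_two_iff cube long_vertices_eq(1)[OF assms] by simp
qed

lemma block_pair:
  assumes "f.long = {}" "B \<in> P" "i \<in> B"
  shows "B = {i, f i}"
proof -
  have i: "i < N" using part assms by (auto simp: partition_on_def)
  have fi: "f i = csucc B i" "f i \<in> B" using part_perm_eq[OF part assms(2,3)] part_perm_mem_block[OF part assms(2,3)] by auto
  have "csucc B (f i) = i"
    using part_perm_eq[OF part assms(2) fi(2)] assms(1) i by (auto simp: f.long_def)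
  then show ?thesis using fi no_fix[OF i] assms(3) by (intro csucc_pair) auto
qed

lemma eq_pairs:
  assumes "f.long = {}"
  shows "P = (\<lambda>i. {i, f i}) ` {..<N}" "N = 2 * card P"
proof -
  show "P = (\<lambda>i. {i, f i}) ` {..<N}"
  proof (intro equalityI subsetI)
    fix B assume B: "B \<in> P"
    then have "B \<noteq> {}" using part by (auto simp: partition_on_def)
    then obtain i where i: "i \<in> B" by blast
    then have "i < N" using part B by (auto simp: partition_on_def)
    then show "B \<in> (\<lambda>i. {i, f i}) ` {..<N}" using block_pair[OF assms B i] by auto
  next
    fix B assume "B \<in> (\<lambda>i. {i, f i}) ` {..<N}"
    then obtain i where i: "i < N" "B = {i, f i}" by auto
    then show "B \<in> P"
      using block_pair[OF assms block_mem[OF part, of i]] block_mem(1)[OF part, of i] by simp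
  qed
  have "card B = 2" if B: "B \<in> P" for B
  proof -
    have "B \<noteq> {}" using part B by (auto simp: partition_on_def)
    then obtain i where i: "i \<in> B" by blast
    then have "i < N" using part B by (auto simp: partition_on_def)
    then show ?thesis using block_pair[OF assms B i] no_fix[of i] by auto
  qed
  then show "N = 2 * card P" using card_partition_pairs[OF _ part] by simp
qed

end

section \<open>Passing between a diagram and its lift\<close>

locale lifted = chord_lift "int N" a for N :: nat and a :: "int \<Rightarrow> int" +
  fixes f :: "nat \<Rightarrow> nat"
  assumes lift: "a i mod int N = int (f (nat (i mod int N)))"
begin

lemma N_pos: "0 < N"
  using n_pos by simp

lemma lift_Suc: "f (Suc (nat (i mod int N)) mod N) = nat (a (i + 1) mod int N)"
proof -
  have "int (Suc (nat (i mod int N)) mod N) = (i mod int N + 1) mod int N"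
    using N_pos by (simp add: zmod_int algebra_simps)
  also have "\<dots> = (i + 1) mod int N" by (simp add: mod_simps)
  finally have "Suc (nat (i mod int N)) mod N = nat ((i + 1) mod int N)" by simp
  then show ?thesis using lift[of "i + 1"] by simp
qed

lemma lift_Suc_Suc: "f (Suc (f (Suc (nat (i mod int N)) mod N)) mod N) = nat (a (a (i + 1) + 1) mod int N)"
  by (simp only: lift_Suc)

lemma lift_Suc_Suc_Suc:
  "f (Suc (f (Suc (f (Suc (nat (i mod int N)) mod N)) mod N)) mod N)
     = nat (a (a (a (i + 1) + 1) + 1) mod int N)"
  by (simp only: lift_Suc)

lemma nat_mod_eq_iff: "nat (i mod int N) = nat (j mod int N) \<longleftrightarrow> i mod int N = j mod int N"
  using N_pos by (simp add: eq_nat_nat_iff)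

text \<open>If beta squared fixes \<open>i\<close> modulo N, then \<open>a (i + 1) + 1\<close> and
  \<open>a i\<close> are congruent; the bounds on \<open>a\<close> put them less than N apart, so
  they are equal.\<close>

lemma breaks_iff: "i \<in> breaks \<longleftrightarrow> nat (i mod int N) \<in> long_vertices N f"
proof -
  have "i \<notin> breaks \<longleftrightarrow> a (a (i + 1) + 1) mod int N = i mod int N"
  proof
    assume "i \<notin> breaks"
    then have "a (i + 1) + 1 = a i" by (simp add: breaks_def)
    then show "a (a (i + 1) + 1) mod int N = i mod int N" by (simp add: twice)
  next
    let ?u = "a (i + 1) + 1"
    assume *: "a ?u mod int N = i mod int N"
    have "a (a ?u) mod int N = a i mod int N" using lift[of "a ?u"] lift[of i] * by simp
    then have "int N dvd ?u - a i" by (simp add: twice mod_eq_dvd_iff)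
    moreover have "\<bar>?u - a i\<bar> < int N" using gt[of i] lt[of i] gt[of "i + 1"] lt[of "i + 1"] by auto
    ultimately have "?u = a i" using zdvd_imp_le[of "int N" "\<bar>?u - a i\<bar>"] by force
    then show "i \<notin> breaks" by (simp add: breaks_def)
  qed
  then show ?thesis
    using N_pos by (auto simp: long_vertices_def lift_Suc_Suc nat_mod_eq_iff nat_less_iff)
qed

lemma breaks_int_iff: "j < N \<Longrightarrow> int j \<in> breaks \<longleftrightarrow> j \<in> long_vertices N f"
  using breaks_iff[of "int j"] by simp

lemma card_breaks: "card (breaks \<inter> {0..<int N}) = card (long_vertices N f)"
proof -
  have "breaks \<inter> {0..<int N} = int ` long_vertices N f"
  proof (intro equalityI subsetI)
    fix i assume i: "i \<in> breaks \<inter> {0..<int N}"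
    then have "i = int (nat i)" "nat i < N" by auto
    then show "i \<in> int ` long_vertices N f" using breaks_int_iff[of "nat i"] i by (metis IntD1 imageI)
  next
    fix i assume "i \<in> int ` long_vertices N f"
    then show "i \<in> breaks \<inter> {0..<int N}" using breaks_int_iff by (auto simp: long_vertices_def)
  qed
  then show ?thesis by (simp add: card_image)
qed

lemma cube_iff:
  "(\<forall>j\<in>long_vertices N f. f (Suc (f (Suc (f (Suc j mod N)) mod N)) mod N) = j)
    \<longleftrightarrow> (\<forall>i\<in>breaks. a (a (a (i + 1) + 1) + 1) mod int N = i mod int N)"
proof -
  have *: "f (Suc (f (Suc (f (Suc (nat (i mod int N)) mod N)) mod N)) mod N) = nat (i mod int N)
      \<longleftrightarrow> a (a (a (i + 1) + 1) + 1) mod int N = i mod int N" for i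
    by (simp only: lift_Suc_Suc_Suc nat_mod_eq_iff)
  show ?thesis
  proof
    assume "\<forall>j\<in>long_vertices N f. f (Suc (f (Suc (f (Suc j mod N)) mod N)) mod N) = j"
    then show "\<forall>i\<in>breaks. a (a (a (i + 1) + 1) + 1) mod int N = i mod int N"
      using * breaks_iff by blast
  next
    assume 1: "\<forall>i\<in>breaks. a (a (a (i + 1) + 1) + 1) mod int N = i mod int N"
    show "\<forall>j\<in>long_vertices N f. f (Suc (f (Suc (f (Suc j mod N)) mod N)) mod N) = j"
    proof
      fix j assume j: "j \<in> long_vertices N f"
      then have "j < N" by (simp add: long_vertices_def)
      then show "f (Suc (f (Suc (f (Suc j mod N)) mod N)) mod N) = j"
        using *[of "int j"] 1 breaks_int_iff j by simp
    qed
  qed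
qed

end

text \<open>The displacement \<open>d i\<close> is the distance forward to the partner, reduced
  modulo N. It is positive because \<open>f\<close> has no fixed point, and not 1 because no point
  is joined to its successor.\<close>

lemma ex_lift:
  assumes N: "0 < N" and f: "\<And>i. i < N \<Longrightarrow> f i < N" "\<And>i. i < N \<Longrightarrow> f (f i) = i"
    "\<And>i. i < N \<Longrightarrow> f i \<noteq> i" "\<And>i. i < N \<Longrightarrow> f i \<noteq> Suc i mod N"
  shows "\<exists>a. lifted N a f"
proof -
  let ?n = "int N"
  define F where "F i = int (f (nat (i mod ?n)))" for i
  define d where "d i = (F i - i) mod ?n" for i
  define a where "a i = i + d i" for i
  have nat_mod: "nat (i mod ?n) < N" for i using N by (simp add: nat_less_iff)
  have F: "0 \<le> F i" "F i < ?n" for i using f(1)[OF nat_mod] by (auto simp: F_def)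
  have lift: "a i mod ?n = F i" for i
    using F[of i] by (simp add: a_def d_def mod_simps)
  have F_mod: "F i = F j" if "i mod ?n = j mod ?n" for i j using that by (simp add: F_def)
  have FF: "F (a i) = i mod ?n" for i
  proof -
    have "nat (a i mod ?n) = f (nat (i mod ?n))" using lift[of i] by (simp add: F_def)
    then show ?thesis using f(2)[OF nat_mod] N by (simp add: F_def)
  qed
  have F_neq: "F i \<noteq> i mod ?n" for i
    using f(3)[OF nat_mod, of i] N by (auto simp: F_def)
  have d: "0 < d i" "d i < ?n" for i
  proof -
    have "d i \<noteq> 0"
    proof
      assume "d i = 0"
      then have "F i mod ?n = i mod ?n" by (simp add: d_def mod_eq_dvd_iff dvd_eq_mod_eq_0)
      then show False using F F_neq by simp
    qed
    then show "0 < d i" using N by (simp add: d_def order_le_neq_trans)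
    show "d i < ?n" using N by (simp add: d_def)
  qed
  show ?thesis
  proof (intro exI, unfold_locales)
    fix i
    show "a (i + ?n) = a i + ?n"
      using F_mod[of "i + ?n" i] mod_diff_right_eq[of "F i" "i + ?n" ?n] mod_diff_right_eq[of "F i" i ?n]
      by (simp add: a_def d_def)
    have "d (a i) = (i - a i) mod ?n"
      unfolding d_def FF by (simp add: mod_simps)
    also have "\<dots> = (- d i) mod ?n" by (simp add: a_def)
    also have "\<dots> = ?n - d i" using d[of i] by (simp add: zmod_zminus1_eq_if)
    finally show "a (a i) = i + ?n" by (simp add: a_def)
    show "a i < i + ?n" using d by (simp add: a_def)
    show "i + 1 < a i"
    proof (rule ccontr)
      assume "\<not> i + 1 < a i"
      then have "a i = i + 1" using d(1)[of i] by (simp add: a_def)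
      then have "F i = (i + 1) mod ?n" using lift[of i] by simp
      moreover have "(i + 1) mod ?n = int (Suc (nat (i mod ?n)) mod N)"
        using N by (simp add: zmod_int mod_simps algebra_simps)
      ultimately show False using f(4)[OF nat_mod, of i] by (simp add: F_def)
    qed
    show "a i mod ?n = int (f (nat (i mod ?n)))" using lift by (simp add: F_def)
  qed
qed

text \<open>A set \<open>K\<close> of breaks in a half circle of \<open>c\<close> points stands for
  its closure under translation by \<open>c\<close>.\<close>

definition lift_set :: "nat \<Rightarrow> nat set \<Rightarrow> int set" where
  "lift_set c K = {x. nat (x mod int c) \<in> K}"

definition partner :: "nat \<Rightarrow> nat set \<Rightarrow> nat \<Rightarrow> nat" where
  "partner c K i = nat (reflect (lift_set c K) (int c) (int i) mod int (2 * c))"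

definition diagram :: "nat \<Rightarrow> nat set \<Rightarrow> nat set set" where
  "diagram c K = (\<lambda>i. {i, partner c K i}) ` {..<2 * c}"

lemma partition_on_pairs:
  assumes "\<And>i. i \<in> A \<Longrightarrow> f i \<in> A" "\<And>i. i \<in> A \<Longrightarrow> f (f i) = i"
  shows "partition_on A ((\<lambda>i. {i, f i}) ` A)"
proof (rule partition_onI)
  show "disjnt B C" if BC: "B \<in> (\<lambda>i. {i, f i}) ` A" "C \<in> (\<lambda>i. {i, f i}) ` A" "B \<noteq> C" for B C
  proof -
    obtain i j where ij: "i \<in> A" "j \<in> A" "B = {i, f i}" "C = {j, f j}" using BC by auto
    have "{k, f k} = {i, f i}" if "k \<in> {i, f i}" "i \<in> A" for i k using that assms(2) by auto
    from this[OF _ ij(1)] this[OF _ ij(2)] have "k \<notin> C" if "k \<in> B" for k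
      using that BC(3) ij(3,4) by metis
    then show ?thesis by (auto simp: disjnt_def)
  qed
qed (use assms in auto)

text \<open>The reflected runs have \<open>K\<close> and its antipodes as breaks, 4 or 6 in number;
  for 6, the third iterate of beta is trivial on them by \<open>reflect_cube\<close>. Reading off
  the breaks in the first half recovers \<open>K\<close>, so distinct sets give distinct
  diagrams.\<close>

lemma diagram_irreducible:
  assumes K: "K \<subseteq> {..<c}" "card K = 2 \<or> card K = 3"
  shows "diagram c K \<in> irreducible_partitions (2 * c)" "card (diagram c K) = c"
    "long_vertices (2 * c) (part_perm (diagram c K)) \<inter> {..<c} = K"
proof -
  define N where "N = 2 * c"
  define X where "X = lift_set c K"
  define a where "a = reflect X (int c)"
  define f where "f = partner c K"
  define P where "P = diagram c K"
  have "K \<noteq> {}" using K by auto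
  then have c: "0 < c" using K by auto
  have X_int: "int j \<in> X \<longleftrightarrow> j \<in> K" if "j < c" for j using that by (simp add: X_def lift_set_def)
  interpret X: periodic_set X "int c"
  proof
    show "X \<noteq> {}" using X_int K \<open>K \<noteq> {}\<close> by blast
  qed (use c in \<open>auto simp: X_def lift_set_def\<close>)
  have "X \<inter> {0..<int c} = int ` K"
  proof (intro equalityI subsetI)
    fix x assume x: "x \<in> X \<inter> {0..<int c}"
    then have "int (nat x) = x" "nat x < c" by auto
    then show "x \<in> int ` K" using X_int[of "nat x"] x by (metis IntD1 imageI)
  qed (use X_int K in auto)
  then have cardX: "card (X \<inter> {0..<int c}) = card K" by (simp add: card_image)
  then have two: "2 \<le> card (X \<inter> {0..<int c})" using K by auto
  have N2: "int N = 2 * int c" by (simp add: N_def)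
  interpret chord_lift "int N" a
    unfolding N2 a_def by (rule X.reflect_chord_lift[OF two])
  have breaks: "breaks = X"
    using X.breaks_reflect[OF two] by (simp add: a_def)
  have N0: "0 < N" using c by (simp add: N_def)
  have f: "f i = nat (a (int i) mod int N)" for i
    by (simp add: f_def partner_def a_def X_def N_def)
  have lift: "a i mod int N = int (f (nat (i mod int N)))" for i
    using N0 a_mod[of i] by (simp add: f)
  interpret lifted N a f by unfold_locales (rule lift)
  have f_less: "f i < N" for i using N0 by (simp add: f nat_less_iff)
  have f_f: "f (f i) = i" if "i < N" for i
    using lift[of "a (int i)"] that by (simp add: f twice)
  have f_fix: "f i \<noteq> i" if "i < N" for i
  proof
    assume "f i = i"
    then have "a (int i) mod int N = int i mod int N" using lift[of "int i"] that by simp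
    then have "int N dvd a (int i) - int i" by (simp add: mod_eq_dvd_iff)
    then show False using gt[of "int i"] lt[of "int i"] zdvd_imp_le[of "int N" "a (int i) - int i"] by simp
  qed
  have f_Suc: "f i \<noteq> Suc i mod N" if "i < N" for i
  proof
    assume "f i = Suc i mod N"
    then have "a (int i) mod int N = (int i + 1) mod int N"
      using lift[of "int i"] that by (simp add: zmod_int add.commute)
    then have "int N dvd a (int i) - (int i + 1)" by (simp add: mod_eq_dvd_iff)
    then show False
      using gt[of "int i"] lt[of "int i"] zdvd_imp_le[of "int N" "a (int i) - (int i + 1)"] by simp
  qed
  have P: "P = (\<lambda>i. {i, f i}) ` {..<N}" by (simp add: P_def diagram_def f_def N_def)
  have part: "partition_on {..<N} P" unfolding P using f_less f_f by (intro partition_on_pairs) auto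
  have perm: "part_perm P i = f i" if "i < N" for i
  proof -
    have "part_perm P i = csucc {i, f i} i" using that by (intro part_perm_eq[OF part]) (auto simp: P)
    then show ?thesis using csucc_doubleton f_fix[OF that] by metis
  qed
  interpret P: irreducible_partition N P
    using part perm f_fix f_Suc by unfold_locales auto
  have long: "P.f.long = {}" using perm f_f f_less by (auto simp: P.f.long_def)
  have long_vertices: "long_vertices N (part_perm P) = long_vertices N f"
    using perm f_less N0 by (simp add: long_vertices_def cong: conj_cong)
  have "card (long_vertices N f) = 2 * card K"
  proof -
    have "card (X \<inter> {0..<int N}) = card (X \<inter> {0..<int c} \<union> X \<inter> {int c..<int c + int c})"
      by (rule arg_cong[of _ _ card]) (auto simp: N2)
    also have "\<dots> = card (X \<inter> {0..<int c}) + card (X \<inter> {int c..<int c + int c})"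
      by (rule card_Un_disjoint) auto
    finally show ?thesis using card_breaks X.card_period[of "int c"] cardX by (simp add: breaks)
  qed
  moreover have "\<forall>j\<in>long_vertices N f. f (Suc (f (Suc (f (Suc j mod N)) mod N)) mod N) = j" if "card K = 3"
    unfolding cube_iff breaks
  proof
    fix t assume "t \<in> X"
    from X.reflect_cube[OF _ this] that cardX
    have "a (a (a (t + 1) + 1) + 1) = t + 2 * int N" unfolding a_def N2 by simp
    then show "a (a (a (t + 1) + 1) + 1) mod int N = t mod int N" by simp
  qed
  moreover have "f (Suc (f (Suc (f (Suc j mod N)) mod N)) mod N)
      = part_perm P (Suc (part_perm P (Suc (part_perm P (Suc j mod N)) mod N)) mod N)" for j
    using perm N0 by simp
  ultimately have "P \<in> genus_one {..<N}"
    unfolding P.genus_one_iff[OF long] long_vertices using K(2) by auto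
  then show "diagram c K \<in> irreducible_partitions (2 * c)"
    using P.no_fix P.no_succ part_perm_lessThan
    by (auto simp: irreducible_partitions_def P_def N_def)
  show "card (diagram c K) = c"
    using P.eq_pairs(2)[OF long] by (simp add: P_def N_def)
  have "j \<in> long_vertices N f \<longleftrightarrow> j \<in> K" if "j < c" for j
    using breaks_int_iff[of j] X_int[OF that] that by (simp add: breaks N_def)
  then show "long_vertices (2 * c) (part_perm (diagram c K)) \<inter> {..<c} = K"
    using K(1) long_vertices by (auto simp: P_def N_def)
qed

text \<open>There are 4 or 6 breaks, and both sides of every chord contain at least 2, respectively
  3, of them; so every chord halves the set of breaks, as \<open>half_structure\<close>
  requires.\<close>

lemma irreducible_eq_diagram:
  assumes "P \<in> irreducible_partitions N"
  obtains c K where "N = 2 * c" "K \<subseteq> {..<c}" "card K = 2 \<or> card K = 3" "P = diagram c K"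
proof -
  have genus: "P \<in> genus_one {..<N}" using assms by (simp add: irreducible_partitions_def)
  interpret P: irreducible_partition N P
    using assms part_perm_lessThan
    by unfold_locales (auto simp: irreducible_partitions_def genus_one_def)
  note long = P.involution[OF genus]
  define c where "c = card P"
  have N: "N = 2 * c" using P.eq_pairs(2)[OF long] by (simp add: c_def)
  have "\<not> card {..<N} \<le> 1" using genus genus_one_small[of "{..<N}"] by blast
  then have c0: "0 < c" using N by simp
  let ?f = "part_perm P"
  have ff: "?f (?f i) = i" if "i < N" for i using long that by (auto simp: P.f.long_def)
  obtain a where "lifted N a ?f"
    using ex_lift[of N ?f] c0 N P.f_less ff P.no_fix P.no_succ by auto
  then interpret lifted N a ?f .
  have "\<exists>h. (h = 2 \<or> h = 3) \<and> card (breaks \<inter> {0..<int N}) = 2 * h \<and> (\<forall>i. card (breaks \<inter> {i..<a i}) = h)"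
  proof -
    consider "card (breaks \<inter> {0..<int N}) = 4"
      | "card (breaks \<inter> {0..<int N}) = 6"
        "\<And>y. y \<in> breaks \<Longrightarrow> a (a (a (y + 1) + 1) + 1) mod int N = y mod int N"
      using genus unfolding P.genus_one_iff[OF long] cube_iff card_breaks by blast
    then show ?thesis
    proof cases
      case 1
      have "card (breaks \<inter> {i..<a i}) = 2" for i
        using card_breaks_split[of i] card_breaks_ge2[of i] card_breaks_ge2[of "a i"] 1 by simp
      then show ?thesis using 1 by (intro exI[of _ 2]) simp
    next
      case 2
      have "card (breaks \<inter> {i..<a i}) = 3" for i
        using card_breaks_split[of i] card_breaks_ge3[OF 2(2), of i] card_breaks_ge3[OF 2(2), of "a i"] 2(1)
        by simp
      then show ?thesis using 2 by (intro exI[of _ 3]) simp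
    qed
  qed
  then obtain h where h: "h = 2 \<or> h = 3" "card (breaks \<inter> {0..<int N}) = 2 * h"
    "\<And>i. card (breaks \<inter> {i..<a i}) = h" by blast
  have h0: "0 < h" and N2: "int N = 2 * int c" using h(1) N by auto
  note struct = half_structure[OF h(3,2) h0 N2]
  interpret c: periodic_set breaks "int c"
    using struct(1) c0 breaks.nonempty by unfold_locales auto
  define K where "K = {j. j < c \<and> int j \<in> breaks}"
  have lift_set: "lift_set c K = breaks"
  proof -
    have "x \<in> lift_set c K \<longleftrightarrow> x mod int c \<in> breaks" for x
      using c0 by (auto simp: lift_set_def K_def nat_less_iff)
    then show ?thesis using c.mod_mem_iff by blast
  qed
  have "card K = h"
  proof -
    have "card (breaks \<inter> {0..<int N}) = card (breaks \<inter> {0..<int c} \<union> breaks \<inter> {int c..<int c + int c})"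
      by (rule arg_cong[of _ _ card]) (auto simp: N2)
    also have "\<dots> = card (breaks \<inter> {0..<int c}) + card (breaks \<inter> {int c..<int c + int c})"
      by (rule card_Un_disjoint) auto
    finally have "card (breaks \<inter> {0..<int c}) = h" using h(2) c.card_period[of "int c"] by simp
    moreover have "breaks \<inter> {0..<int c} = int ` K"
    proof (intro equalityI subsetI)
      fix x assume x: "x \<in> breaks \<inter> {0..<int c}"
      then have "int (nat x) = x" "nat x < c" by auto
      then show "x \<in> int ` K" using x by (auto simp: K_def intro!: image_eqI[of _ _ "nat x"])
    qed (auto simp: K_def)
    ultimately show ?thesis by (simp add: card_image)
  qed
  moreover have "partner c K i = ?f i" if "i < N" for i
  proof -
    obtain p q where r: "run breaks (int i) p q" using breaks.ex_run by blast
    have "reflect breaks (int c) (int i) = a (int i)"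
      using reflect_eq[OF r] struct(2)[OF r] by simp
    then have "partner c K i = nat (a (int i) mod int N)"
      by (simp add: partner_def lift_set N)
    then show ?thesis using lift[of "int i"] that by simp
  qed
  then have "P = diagram c K"
    using P.eq_pairs(1)[OF long] by (auto simp: diagram_def N intro!: image_cong)
  ultimately show ?thesis using that[of c K] N h(1) by (auto simp: K_def)
qed

lemma sum_irreducible_partitions_eq:
  "(\<Sum>P\<in>irreducible_partitions n. fps_X ^ card P)
    = (if even n then of_nat (((n div 2) choose 2) + ((n div 2) choose 3)) * (fps_X :: rat fps) ^ (n div 2) else 0)"
proof (cases "even n")
  case False
  have "P \<notin> irreducible_partitions n" for P
  proof
    assume "P \<in> irreducible_partitions n"
    then obtain c where "n = 2 * c" by (rule irreducible_eq_diagram)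
    then show False using False by simp
  qed
  then have "irreducible_partitions n = {}" by blast
  then show ?thesis using False by simp
next
  case True
  then obtain c where c: "n = 2 * c" by (elim evenE)
  define Ks where "Ks = {K. K \<subseteq> {..<c} \<and> (card K = 2 \<or> card K = 3)}"
  have "(\<Sum>P\<in>irreducible_partitions n. fps_X ^ card P) = (\<Sum>K\<in>Ks. fps_X ^ c :: rat fps)"
  proof (rule sum.reindex_bij_witness[of _ "diagram c" "\<lambda>P. long_vertices n (part_perm P) \<inter> {..<c}"])
    fix P assume "P \<in> irreducible_partitions n"
    then obtain c' K where "n = 2 * c'" "K \<subseteq> {..<c'}" "card K = 2 \<or> card K = 3" "P = diagram c' K"
      by (rule irreducible_eq_diagram)
    then have K: "K \<in> Ks" "P = diagram c K" using c by (simp_all add: Ks_def)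
    note d = diagram_irreducible[of K c]
    show "diagram c (long_vertices n (part_perm P) \<inter> {..<c}) = P"
      "long_vertices n (part_perm P) \<inter> {..<c} \<in> Ks" "fps_X ^ c = (fps_X ^ card P :: rat fps)"
      using d K c by (auto simp: Ks_def)
  next
    fix K assume "K \<in> Ks"
    then show "long_vertices n (part_perm (diagram c K)) \<inter> {..<c} = K"
      "diagram c K \<in> irreducible_partitions n"
      using diagram_irreducible[of K c] c by (auto simp: Ks_def)
  qed
  also have "\<dots> = of_nat (card Ks) * fps_X ^ c" by simp
  also have "card Ks = (c choose 2) + (c choose 3)"
  proof -
    have "Ks = {K. K \<subseteq> {..<c} \<and> card K = 2} \<union> {K. K \<subseteq> {..<c} \<and> card K = 3}"
      by (auto simp: Ks_def)
    also have "card \<dots> = card {K. K \<subseteq> {..<c} \<and> card K = 2} + card {K. K \<subseteq> {..<c} \<and> card K = 3}"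
      by (rule card_Un_disjoint) auto
    finally show ?thesis by (simp add: n_subsets)
  qed
  finally show ?thesis using c by simp
qed

section \<open>The generating function\<close>

text \<open>Each induction step is Pascal's rule.\<close>

lemma choose_gf:
  "(1 - fps_X) ^ Suc k * Abs_fps (\<lambda>c. of_nat (c choose k)) = (fps_X ^ k :: 'a::comm_ring_1 fps)"
proof (induction k)
  case 0
  show ?case
  proof (rule fps_ext)
    fix n
    show "fps_nth ((1 - fps_X) ^ Suc 0 * Abs_fps (\<lambda>c. of_nat (c choose 0))) n = fps_nth (fps_X ^ 0 :: 'a fps) n"
      by (cases n) (simp_all add: left_diff_distrib)
  qed
next
  case (Suc k)
  have step: "(1 - fps_X) * Abs_fps (\<lambda>c. of_nat (c choose Suc k)) = fps_X * (Abs_fps (\<lambda>c. of_nat (c choose k)) :: 'a fps)"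
  proof (rule fps_ext)
    fix n
    show "fps_nth ((1 - fps_X) * Abs_fps (\<lambda>c. of_nat (c choose Suc k))) n
      = fps_nth (fps_X * (Abs_fps (\<lambda>c. of_nat (c choose k)) :: 'a fps)) n"
      by (cases n) (simp_all add: left_diff_distrib)
  qed
  have "(1 - fps_X) ^ Suc (Suc k) * Abs_fps (\<lambda>c. of_nat (c choose Suc k))
      = (1 - fps_X) ^ Suc k * ((1 - fps_X) * (Abs_fps (\<lambda>c. of_nat (c choose Suc k)) :: 'a fps))"
    by (simp only: power_Suc2[of _ "Suc k"] mult.assoc)
  also have "\<dots> = fps_X * ((1 - fps_X) ^ Suc k * Abs_fps (\<lambda>c. of_nat (c choose k)))"
    unfolding step by (rule mult.left_commute)
  finally have "(1 - fps_X) ^ Suc (Suc k) * Abs_fps (\<lambda>c. of_nat (c choose Suc k))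
      = fps_X * ((1 - fps_X) ^ Suc k * (Abs_fps (\<lambda>c. of_nat (c choose k)) :: 'a fps))" .
  then show ?case using Suc.IH by simp
qed

lemma irreducible_gf:
  fixes y :: "'a::idom"
  defines "z \<equiv> fps_const y * fps_X ^ 2"
  shows "(1 - z) ^ 4 * Abs_fps (\<lambda>n. if even n then of_nat (((n div 2) choose 2) + ((n div 2) choose 3)) * y ^ (n div 2) else 0)
    = z ^ 2"
proof -
  define B where "B k = (Abs_fps (\<lambda>c. of_nat (c choose k)) :: 'a fps)" for k
  have z0: "fps_nth z 0 = 0" by (simp add: z_def)
  have zpow: "fps_nth (z ^ i) n = (if n = 2 * i then y ^ i else 0)" for i n
    by (simp add: z_def power_mult_distrib fps_const_power flip: power_mult)
  have "Abs_fps (\<lambda>n. if even n then of_nat (((n div 2) choose 2) + ((n div 2) choose 3)) * y ^ (n div 2) else 0)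
      = (B 2 + B 3) oo z"
  proof (rule fps_ext)
    fix n
    have "fps_nth ((B 2 + B 3) oo z) n = (\<Sum>i=0..n. if n = 2 * i then of_nat ((i choose 2) + (i choose 3)) * y ^ i else 0)"
      unfolding fps_compose_nth by (intro sum.cong) (auto simp: zpow B_def)
    also have "\<dots> = (if even n then of_nat (((n div 2) choose 2) + ((n div 2) choose 3)) * y ^ (n div 2) else 0)"
    proof (cases "even n")
      case True
      have "(\<Sum>i=0..n. if n = 2 * i then of_nat ((i choose 2) + (i choose 3)) * y ^ i else 0)
          = (\<Sum>i=0..n. if i = n div 2 then of_nat ((i choose 2) + (i choose 3)) * y ^ i else 0)"
        using True by (intro sum.cong refl) auto
      then show ?thesis using True by simp
    qed (auto intro!: sum.neutral)
    finally show "fps_nth (Abs_fps (\<lambda>n. if even n then of_nat (((n div 2) choose 2) + ((n div 2) choose 3)) * y ^ (n div 2) else 0)) n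
      = fps_nth ((B 2 + B 3) oo z) n" by simp
  qed
  \<comment> \<open>The two series contribute (1 - X) X^2 and X^3, whose sum collapses; the
    coefficients combine to binom(c + 1, 3).\<close>
  moreover have "(1 - fps_X) ^ 4 * (B 2 + B 3) = fps_X ^ 2"
  proof -
    have "(1 - fps_X) ^ 4 * (B 2 + B 3)
        = (1 - fps_X) * ((1 - fps_X) ^ Suc 2 * B 2) + (1 - fps_X) ^ Suc 3 * B 3"
      by (simp add: algebra_simps eval_nat_numeral)
    also have "\<dots> = fps_X ^ 2"
      unfolding B_def choose_gf by (simp add: algebra_simps eval_nat_numeral)
    finally show ?thesis .
  qed
  then have "((1 - fps_X) ^ 4 * (B 2 + B 3)) oo z = fps_X ^ 2 oo z" by simp
  ultimately show ?thesis
    by (simp add: fps_compose_mult_distrib[OF z0] fps_compose_power[OF z0, symmetric] fps_compose_sub_distrib z0)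
qed

lemma fps_qpow_nth_0: "fps_nth (fps_qpow F a) 0 = 1"
  by (simp add: fps_qpow_def)

lemma fps_qpow_of_nat:
  assumes "fps_nth F 0 = 1"
  shows "fps_qpow F (of_nat (Suc n)) = F ^ Suc n"
proof (induction n)
  case (Suc n)
  have "fps_qpow F (1 + of_nat (Suc n)) = F * F ^ Suc n"
    using Suc by (subst fps_qpow_add[OF assms]) (simp add: fps_qpow_1[OF assms])
  then show ?case by simp
qed (simp add: fps_qpow_1[OF assms])

lemma fps_square_eq:
  fixes a b :: "rat fps fps"
  assumes "a ^ 2 = b ^ 2" "fps_nth a 0 = 1" "fps_nth b 0 = 1"
  shows "a = b"
proof -
  have "a \<noteq> - b"
  proof
    assume "a = - b"
    then have "fps_nth a 0 = - fps_nth b 0" by simp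
    then have "(1 :: rat fps) = - 1" using assms by simp
    then have "fps_nth (1 :: rat fps) 0 = fps_nth (- 1) 0" by (rule arg_cong)
    then show False by simp
  qed
  then show ?thesis using assms(1) by (simp add: power2_eq_iff)
qed

text \<open>The claimed quotient \<open>Q\<close> is composed with \<open>w\<close>. Both
  \<open>P oo w\<close> and \<open>Q oo w\<close> turn out to be \<open>D * z ^ 2\<close> divided by
  \<open>(1 - z) ^ 5\<close>, and \<open>w\<close> is nonzero, so \<open>P\<close> and
  \<open>Q\<close> agree.\<close>

lemma genus_one_gf_compose:
  fixes P :: "rat fps fps"
  defines "D \<equiv> (1 + x_var) * (1 + y_var * x_var)" and "z \<equiv> y_var * x_var ^ 2"
    and "\<Delta> \<equiv> 1 - 2 * (1 + y_var) * x_var + x_var ^ 2 * (1 - y_var) ^ 2"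
  assumes w: "w * D = x_var" "fps_nth w 0 = 0"
    and P: "D * R = (1 - z) * (P oo w)" "(1 - z) ^ 4 * R = z ^ 2"
  shows "P = x_var ^ 4 * y_var ^ 2 / fps_qpow \<Delta> (5 / 2)"
proof -
  define H where "H = fps_qpow \<Delta> (5 / 2)"
  define Q where "Q = x_var ^ 4 * y_var ^ 2 / H"
  have \<Delta>0: "fps_nth \<Delta> 0 = 1" by (simp add: \<Delta>_def)
  have H0: "fps_nth H 0 = 1" by (simp add: H_def fps_qpow_nth_0)
  have QH: "Q * H = x_var ^ 4 * y_var ^ 2"
    unfolding Q_def by (rule fps_divide_const_term_1[OF H0])
  have H2: "H ^ 2 = \<Delta> ^ 5"
    using fps_qpow_add[OF \<Delta>0, of "5/2" "5/2"] fps_qpow_of_nat[OF \<Delta>0, of 4]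
    by (simp add: H_def power2_eq_square)
  have D0: "fps_nth D 0 = 1" by (simp add: D_def)
  have z0: "fps_nth (1 - z) 0 = 1" by (simp add: z_def)
  have comp_x: "x_var oo w = w" using w(2) by simp
  have comp_2: "(2 :: rat fps fps) oo w = 2" by (rule numeral_compose)
  have expand: "(1 - 2 * (1 + a) * b + b ^ 2 * (1 - a) ^ 2) * c ^ 2
      = c ^ 2 - 2 * (1 + a) * (b * c) * c + (b * c) ^ 2 * (1 - a) ^ 2" for a b c :: "rat fps fps"
    by (simp add: algebra_simps power2_eq_square)
  have square: "((1 + b) * (1 + a * b)) ^ 2 - 2 * (1 + a) * b * ((1 + b) * (1 + a * b)) + b ^ 2 * (1 - a) ^ 2
      = (1 - a * b ^ 2) ^ 2" for a b :: "rat fps fps"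
    by (simp add: algebra_simps power2_eq_square)
  have "\<Delta> oo w = 1 - 2 * (1 + y_var) * w + w ^ 2 * (1 - y_var) ^ 2"
    unfolding \<Delta>_def using w(2) comp_2
    by (simp add: fps_compose_add_distrib fps_compose_sub_distrib fps_compose_mult_distrib
        fps_compose_power[symmetric])
  then have "(\<Delta> oo w) * D ^ 2 = D ^ 2 - 2 * (1 + y_var) * (w * D) * D + (w * D) ^ 2 * (1 - y_var) ^ 2"
    using expand[of y_var w D] by simp
  also have "\<dots> = (1 - z) ^ 2"
    unfolding w(1) unfolding D_def z_def by (rule square)
  finally have \<Delta>w: "(\<Delta> oo w) * D ^ 2 = (1 - z) ^ 2" .
  \<comment> \<open>The half-integral power is handled through its square
    \<open>H ^ 2 = \<Delta> ^ 5\<close>: both sides have the same square and constant term 1, which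
    determines the root.\<close>
  have Hw: "(H oo w) * D ^ 5 = (1 - z) ^ 5"
  proof (rule fps_square_eq)
    have "((H oo w) * D ^ 5) ^ 2 = (H ^ 2 oo w) * (D ^ 2) ^ 5"
      by (simp add: power_mult_distrib fps_compose_power[OF w(2)] flip: power_mult)
    also have "\<dots> = ((\<Delta> oo w) * D ^ 2) ^ 5"
      unfolding H2 by (simp only: power_mult_distrib fps_compose_power[OF w(2)])
    also have "\<dots> = ((1 - z) ^ 5) ^ 2"
      unfolding \<Delta>w by (simp flip: power_mult)
    finally show "((H oo w) * D ^ 5) ^ 2 = ((1 - z) ^ 5) ^ 2" .
    show "fps_nth ((H oo w) * D ^ 5) 0 = 1" "fps_nth ((1 - z) ^ 5) 0 = 1"
      using H0 D0 z0 by (simp_all add: fps_power_zeroth_eq_one)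
  qed
  have "(Q oo w) * (H oo w) = w ^ 4 * y_var ^ 2"
    using arg_cong[OF QH, of "\<lambda>f. f oo w"] w(2)
    by (simp add: fps_compose_mult_distrib fps_compose_power[symmetric])
  then have "(Q oo w) * ((H oo w) * D ^ 5) = (w * D) ^ 4 * D * y_var ^ 2"
    by (simp add: power_mult_distrib mult_ac eval_nat_numeral)
  then have Qw: "(1 - z) ^ 5 * (Q oo w) = D * z ^ 2"
    unfolding Hw w(1) by (simp add: z_def power_mult_distrib mult_ac flip: power_mult)
  have "(1 - z) ^ 5 * (P oo w) = (1 - z) ^ 4 * ((1 - z) * (P oo w))"
    by (simp add: eval_nat_numeral mult_ac)
  also have "\<dots> = D * ((1 - z) ^ 4 * R)" unfolding P(1)[symmetric] by (simp add: mult_ac)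
  finally have Pw: "(1 - z) ^ 5 * (P oo w) = D * z ^ 2" unfolding P(2) .
  have "(1 - z) ^ 5 \<noteq> 0" using z0 by auto
  then have "P oo w = Q oo w" using Pw Qw by (metis mult_cancel_left)
  then have "(P - Q) oo w = 0" by (simp add: fps_compose_sub_distrib)
  moreover have "w \<noteq> 0" using w(1) by auto
  ultimately have "P - Q = 0" using fps_compose_eq_0_iff[OF w(2)] by blast
  then show ?thesis by (simp add: Q_def H_def)
qed

text \<open>\<open>P0\<close> sets these coefficients to zero, whereas the series of all genus one
  partitions counts them. That they vanish there is read off from the factor x^4 y^2 of the closed
  form.\<close>

lemma low_coefficients_zero:
  fixes H :: "rat fps fps"
  assumes "fps_nth H 0 = 1" "n < 4 \<or> k < 2"
  shows "fps_nth (fps_nth (x_var ^ 4 * y_var ^ 2 / H) n) k = 0"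
proof -
  define K where "K = 1 / H"
  have "H \<noteq> 0" using assms(1) by auto
  moreover have "x_var ^ 4 * y_var ^ 2 / H * H = (x_var ^ 4 * (y_var ^ 2 * K)) * H"
    using fps_divide_const_term_1[OF assms(1), of "x_var ^ 4 * y_var ^ 2"]
      fps_divide_const_term_1[OF assms(1), of 1] by (simp add: K_def mult.assoc)
  ultimately have "x_var ^ 4 * y_var ^ 2 / H = x_var ^ 4 * (y_var ^ 2 * K)" by simp
  then show ?thesis
    using assms(2) by (auto simp: fps_X_power_mult_nth fps_const_power)
qed

theorem theorem6p1:
  shows "P0 = x_var ^ 4 * y_var ^ 2 /
    fps_qpow (1 - 2 * (1 + y_var) * x_var + x_var ^ 2 * (1 - y_var) ^ 2) (5 / 2)"
proof -
  let ?D = "(1 + x_var) * (1 + y_var * x_var)"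
  define w where "w = x_var / ?D"
  define P where "P = Abs_fps (\<lambda>n. genus_one_poly {..<n})"
  define R where "R = Abs_fps (\<lambda>n. \<Sum>P\<in>irreducible_partitions n. fps_X ^ card P :: rat fps)"
  have w: "w * ?D = x_var" unfolding w_def by (rule fps_divide_const_term_1) simp
  have w0: "fps_nth w 0 = 0" using arg_cong[OF w, of "\<lambda>f. fps_nth f 0"] by simp
  have "?D * R = (1 - y_var * x_var ^ 2) * (P oo w)"
    unfolding R_def P_def sum_irreducible_partitions by (rule cyclic_words_gf[OF w w0])
  moreover have "(1 - y_var * x_var ^ 2) ^ 4 * R = (y_var * x_var ^ 2) ^ 2"
    unfolding R_def sum_irreducible_partitions_eq by (rule irreducible_gf)
  ultimately have P: "P = x_var ^ 4 * y_var ^ 2 /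
      fps_qpow (1 - 2 * (1 + y_var) * x_var + x_var ^ 2 * (1 - y_var) ^ 2) (5 / 2)"
    by (rule genus_one_gf_compose[OF w w0])
  have "fps_nth (fps_nth P n) k = 0" if "n < 4 \<or> k < 2" for n k
    unfolding P by (rule low_coefficients_zero[OF fps_qpow_nth_0 that])
  then have "P0 = P"
    unfolding P0_def by (intro fps_ext) (auto simp: P_def p0_eq not_le)
  then show ?thesis using P by simp
qed

end
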